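(* Let $f,g:[a;b]\to\mathbb{R}$ be two regulated functions which have no common points of discontinuity. Let $\eta_0\ge\eta_1\ge\ldots$ and $\theta_0\ge\theta_1\ge\ldots$ be two sequences of non-negative numbers such that $\eta_k\downarrow0$ and $\theta_k\downarrow0$ as $k\to+\infty$. Define $\theta_{-1}:=\sup_{a\le t\le b}|g(b)-g(t)|$ and \[ \tilde S:=\sum_{k=0}^{+\infty}2^{k}\theta_{k-1}\cdot TV(f,[a;b],\eta_k)+\sum_{k=0}^{+\infty}2^{k}\eta_k\cdot TV(g,[a;b],\theta_k). \] If $\tilde S<+\infty$, then the Riemann–Stieltjes integral $\int_a^b f\,\mathrm{d}g$ exists and \[ \left|\int_a^b f\,\mathrm{d}g-f(a)\left[g(b)-g(a)\right]\right|\le \tilde S. \]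
   Context: A function $h:[a;b]\to\mathbb{R}$ is regulated if the one-sided finite limits $\lim_{t\to a+}h(t)$, $\lim_{t\to b-}h(t)$ exist and, for every $x\in(a;b)$, both finite limits $\lim_{t\to x-}h(t)$ and $\lim_{t\to x+}h(t)$ exist. The total variation is $TV(h,[a;b],0)=\sup_n\sup_{a\le t_1<\dots<t_n\le b}\sum_{i=2}^{n}|h(t_i)-h(t_{i-1})|$. For $\delta\ge0$, the truncated variation is $TV(h,[a;b],\delta):=\inf\{TV(u,[a;b],0):\sup_{a\le t\le b}|h(t)-u(t)|\le\delta/2\}$; for regulated $h$ and $\delta>0$ it equals $\sup_n\sup_{a\le t_1<\dots<t_n\le b}\sum_{i=2}^{n}\max\{|h(t_i)-h(t_{i-1})|-\delta,0\}$. The Riemann–Stieltjes integral $\int_a^b f\,\mathrm{d}g$ exists if the sums $\sum_i f(\nu_i)[g(a_i)-g(a_{i-1})]$ over partitions $a=a_0<\dots<a_l=b$ with tags $\nu_i\in[a_{i-1};a_i]$ converge to a common limit as the mesh $\max_i(a_i-a_{i-1})\to0$, independently of the choice of tags. *)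

theory Defs
  imports "HOL-Analysis.Analysis" "HOL-Library.Extended_Real"
begin

definition regulated_on :: "real \<Rightarrow> real \<Rightarrow> (real \<Rightarrow> real) \<Rightarrow> bool" where
  "regulated_on a b h \<longleftrightarrow>
     (\<exists>L. (h \<longlongrightarrow> L) (at_right a)) \<and>
     (\<exists>L. (h \<longlongrightarrow> L) (at_left b)) \<and>
     (\<forall>x\<in>{a<..<b}. (\<exists>L. (h \<longlongrightarrow> L) (at_left x)) \<and> (\<exists>L. (h \<longlongrightarrow> L) (at_right x)))"

definition total_variation :: "(real \<Rightarrow> real) \<Rightarrow> real \<Rightarrow> real \<Rightarrow> ereal" where
  "total_variation h a b =
     Sup {ereal (\<Sum>i\<in>{1..<n}. \<bar>h (t i) - h (t (i - 1))\<bar>) | n t.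
            (\<forall>i<n. a \<le> t i \<and> t i \<le> b) \<and> (\<forall>i. Suc i < n \<longrightarrow> t i < t (Suc i))}"

definition truncated_variation :: "(real \<Rightarrow> real) \<Rightarrow> real \<Rightarrow> real \<Rightarrow> real \<Rightarrow> ereal" where
  "truncated_variation h a b \<delta> =
     Inf {total_variation u a b | u. \<forall>t\<in>{a..b}. \<bar>h t - u t\<bar> \<le> \<delta> / 2}"

definition RS_has_integral ::
  "(real \<Rightarrow> real) \<Rightarrow> (real \<Rightarrow> real) \<Rightarrow> real \<Rightarrow> real \<Rightarrow> real \<Rightarrow> bool" where
  "RS_has_integral f g a b I \<longleftrightarrow>
     (\<forall>\<epsilon>>0. \<exists>\<delta>>0. \<forall>(l::nat) (p::nat \<Rightarrow> real) (\<nu>::nat \<Rightarrow> real).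
        p 0 = a \<longrightarrow> p l = b \<longrightarrow>
        (\<forall>i<l. p i < p (Suc i)) \<longrightarrow>
        (\<forall>i<l. p (Suc i) - p i < \<delta>) \<longrightarrow>
        (\<forall>i<l. p i \<le> \<nu> i \<and> \<nu> i \<le> p (Suc i)) \<longrightarrow>
        \<bar>(\<Sum>i<l. f (\<nu> i) * (g (p (Suc i)) - g (p i))) - I\<bar> < \<epsilon>)"

end

theory Submission
  imports Defs
begin

text \<open>
  Take nearly optimal approximations \<open>u\<^sub>k\<close> of \<open>f\<close> within \<open>\<eta>\<^sub>k / 2\<close> and \<open>v\<^sub>k\<close> of \<open>g\<close> within
  \<open>\<theta>\<^sub>k / 2\<close>. For a Riemann sum \<open>D(w, h)\<close> normalised by the value of \<open>w\<close> at the left end, put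
  \<open>D\<^sub>k = D(f - u\<^sub>k, g - v\<^sub>k)\<close>. Then
  \<open>D\<^sub>k = D(u\<^sub>k\<^sub>+\<^sub>1 - u\<^sub>k, g - v\<^sub>k) + D(f - u\<^sub>k\<^sub>+\<^sub>1, v\<^sub>k\<^sub>+\<^sub>1 - v\<^sub>k) + D\<^sub>k\<^sub>+\<^sub>1\<close>, where the first two terms are
  at most the product of the supremum of one factor and the variation of the other, after summation
  by parts in the first term. For a fixed partition \<open>D\<^sub>k\<close> tends to \<open>0\<close>, so telescoping gives the bound.

  The same estimate holds uniformly when the Riemann sum is normalised separately on each block of a
  partition. By compactness, on every sufficiently short block \<open>f\<close> or \<open>g\<close> has small oscillation,
  and splitting off \<open>u\<^sub>N\<close> and \<open>v\<^sub>N\<close> shows that the blockwise normalised sums are small, which is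
  the Cauchy criterion. If some \<open>\<eta>\<^sub>k\<close> or \<open>\<theta>\<^sub>k\<close> vanishes, finiteness of the series forces \<open>f\<close> or \<open>g\<close>
  to have bounded variation, and an approximation of the other (regulated) function by one of
  bounded variation takes the place of \<open>v\<^sub>N\<close> or \<open>u\<^sub>N\<close>.
\<close>

section \<open>Total variation and dominating functions\<close>

text \<open>\<open>V\<close> plays the role of a variation function of \<open>w\<close>: bounds on increments then telescope over
  any chain of points.\<close>

definition var_dom :: "real \<Rightarrow> real \<Rightarrow> (real \<Rightarrow> real) \<Rightarrow> (real \<Rightarrow> real) \<Rightarrow> bool" where
  "var_dom a b w V \<longleftrightarrow> (\<forall>x y. a \<le> x \<longrightarrow> x \<le> y \<longrightarrow> y \<le> b \<longrightarrow> \<bar>w y - w x\<bar> \<le> V y - V x)"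

lemma var_domD: "var_dom a b w V \<Longrightarrow> a \<le> x \<Longrightarrow> x \<le> y \<Longrightarrow> y \<le> b \<Longrightarrow> \<bar>w y - w x\<bar> \<le> V y - V x"
  unfolding var_dom_def by blast

lemma var_dom_mono: "var_dom a b w V \<Longrightarrow> a \<le> x \<Longrightarrow> x \<le> y \<Longrightarrow> y \<le> b \<Longrightarrow> V x \<le> V y"
  using var_domD[of a b w V x y] by linarith

definition chain :: "real \<Rightarrow> real \<Rightarrow> nat \<Rightarrow> (nat \<Rightarrow> real) \<Rightarrow> bool" where
  "chain a b n t \<longleftrightarrow> (\<forall>i<n. a \<le> t i \<and> t i \<le> b) \<and> (\<forall>i. Suc i < n \<longrightarrow> t i < t (Suc i))"

lemma total_variation_chain:
  "total_variation h a b = Sup {ereal (\<Sum>i\<in>{1..<n}. \<bar>h (t i) - h (t (i - 1))\<bar>) | n t. chain a b n t}"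
  unfolding total_variation_def chain_def by simp

lemma total_variation_upper:
  "chain a b n t \<Longrightarrow> ereal (\<Sum>i\<in>{1..<n}. \<bar>h (t i) - h (t (i - 1))\<bar>) \<le> total_variation h a b"
  unfolding total_variation_chain by (rule Sup_upper) blast

lemma total_variation_least:
  assumes "\<And>n t. chain a b n t \<Longrightarrow> ereal (\<Sum>i\<in>{1..<n}. \<bar>h (t i) - h (t (i - 1))\<bar>) \<le> c"
  shows "total_variation h a b \<le> c"
  unfolding total_variation_chain by (rule Sup_least) (use assms in blast)

lemma total_variation_nonneg: "0 \<le> total_variation h a b"
  using total_variation_upper[of a b 0 "\<lambda>_. 0" h] by (simp add: chain_def zero_ereal_def)

lemma total_variation_diff:
  "total_variation (\<lambda>x. u x - v x) a b \<le> total_variation u a b + total_variation v a b"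
proof (rule total_variation_least)
  fix n t assume c: "chain a b n t"
  have "(\<Sum>i\<in>{1..<n}. \<bar>(u (t i) - v (t i)) - (u (t (i - 1)) - v (t (i - 1)))\<bar>)
      \<le> (\<Sum>i\<in>{1..<n}. \<bar>u (t i) - u (t (i - 1))\<bar> + \<bar>v (t i) - v (t (i - 1))\<bar>)"
    by (rule sum_mono) linarith
  then have "ereal (\<Sum>i\<in>{1..<n}. \<bar>(u (t i) - v (t i)) - (u (t (i - 1)) - v (t (i - 1)))\<bar>)
      \<le> ereal (\<Sum>i\<in>{1..<n}. \<bar>u (t i) - u (t (i - 1))\<bar>) + ereal (\<Sum>i\<in>{1..<n}. \<bar>v (t i) - v (t (i - 1))\<bar>)"
    by (simp add: sum.distrib)
  also have "\<dots> \<le> total_variation u a b + total_variation v a b"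
    by (intro add_mono total_variation_upper c)
  finally show "ereal (\<Sum>i\<in>{1..<n}. \<bar>(u (t i) - v (t i)) - (u (t (i - 1)) - v (t (i - 1)))\<bar>)
      \<le> total_variation u a b + total_variation v a b" .
qed

lemma chain_append:
  assumes c: "chain a x n t" and xy: "x < y" and ay: "a \<le> y" 
  shows "chain a y (Suc n) (t(n := y))"
  using assms unfolding chain_def
  by (auto simp: less_Suc_eq)

lemma sum_increments_append:
  fixes w :: "real \<Rightarrow> real"
  assumes "0 < n"
  shows "(\<Sum>i\<in>{1..<Suc n}. \<bar>w ((t(n := y)) i) - w ((t(n := y)) (i - 1))\<bar>)
    = (\<Sum>i\<in>{1..<n}. \<bar>w (t i) - w (t (i - 1))\<bar>) + \<bar>w y - w (t (n - 1))\<bar>"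
proof -
  have "(\<Sum>i\<in>{1..<n}. \<bar>w ((t(n := y)) i) - w ((t(n := y)) (i - 1))\<bar>) = (\<Sum>i\<in>{1..<n}. \<bar>w (t i) - w (t (i - 1))\<bar>)"
    by (rule sum.cong) auto
  then show ?thesis using assms by (cases n) auto
qed

text \<open>A chain that stops before \<open>x\<close> can be extended by \<open>x\<close>, which
  only adds a nonnegative term. Fixing the last point allows a further increment starting at
  \<open>x\<close> to be attached.\<close>

lemma chain_ending_at:
  fixes w :: "real \<Rightarrow> real"
  assumes c: "chain a x n t" and ax: "a \<le> x"
  shows "\<exists>n' t'. chain a x (Suc n') t' \<and> t' n' = x \<and>
    (\<Sum>i\<in>{1..<n}. \<bar>w (t i) - w (t (i - 1))\<bar>) \<le> (\<Sum>i\<in>{1..<Suc n'}. \<bar>w (t' i) - w (t' (i - 1))\<bar>)"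
proof (cases n)
  case 0
  then show ?thesis using ax by (intro exI[of _ 0] exI[of _ "\<lambda>_. x"]) (auto simp: chain_def)
next
  case (Suc k)
  show ?thesis
  proof (cases "t k = x")
    case True
    then show ?thesis using c Suc by (intro exI[of _ k] exI[of _ t]) auto
  next
    case False
    then have "t k < x" using c Suc by (auto simp: chain_def order_le_less)
    then have "chain a x (Suc n) (t(n := x))"
      using c Suc ax unfolding chain_def by (auto simp: less_Suc_eq)
    moreover have "(\<Sum>i\<in>{1..<n}. \<bar>w (t i) - w (t (i - 1))\<bar>) \<le>
        (\<Sum>i\<in>{1..<Suc n}. \<bar>w ((t(n := x)) i) - w ((t(n := x)) (i - 1))\<bar>)"
      by (subst sum_increments_append) (use Suc in auto)
    ultimately show ?thesis by (intro exI[of _ n] exI[of _ "t(n := x)"]) simp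
  qed
qed

text \<open>Chains up to \<open>x\<close> may be taken to end at \<open>x\<close>; appending
  \<open>y\<close> then adds exactly the increment from \<open>x\<close> to \<open>y\<close>. The
  case \<open>x = y\<close> is separate because chains are strictly increasing.\<close>

lemma total_variation_step:
  assumes "a \<le> x" "x \<le> y"
  shows "total_variation w a x + ereal \<bar>w y - w x\<bar> \<le> total_variation w a y"
proof (cases "x = y")
  case True
  then show ?thesis by simp
next
  case False
  \<comment> \<open>With the finite increment moved to the right, the claim is an upper bound for a
    supremum over chains.\<close>
  have "total_variation w a x \<le> total_variation w a y - ereal \<bar>w y - w x\<bar>"
  proof (rule total_variation_least)
    fix n t assume "chain a x n t"
    from chain_ending_at[OF this assms(1), of w] obtain n' t' where t': "chain a x (Suc n') t'" "t' n' = x" and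
      le: "(\<Sum>i\<in>{1..<n}. \<bar>w (t i) - w (t (i - 1))\<bar>) \<le> (\<Sum>i\<in>{1..<Suc n'}. \<bar>w (t' i) - w (t' (i - 1))\<bar>)"
      by blast
    have "chain a y (Suc (Suc n')) (t'(Suc n' := y))"
      by (rule chain_append[OF t'(1)]) (use assms False in auto)
    from total_variation_upper[OF this, of w]
    have "ereal ((\<Sum>i\<in>{1..<Suc n'}. \<bar>w (t' i) - w (t' (i - 1))\<bar>) + \<bar>w y - w x\<bar>) \<le> total_variation w a y"
      by (subst (asm) sum_increments_append) (simp_all add: t')
    moreover have "ereal ((\<Sum>i\<in>{1..<n}. \<bar>w (t i) - w (t (i - 1))\<bar>) + \<bar>w y - w x\<bar>) \<le>
      ereal ((\<Sum>i\<in>{1..<Suc n'}. \<bar>w (t' i) - w (t' (i - 1))\<bar>) + \<bar>w y - w x\<bar>)" using le by simp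
    ultimately have "ereal ((\<Sum>i\<in>{1..<n}. \<bar>w (t i) - w (t (i - 1))\<bar>) + \<bar>w y - w x\<bar>) \<le> total_variation w a y"
      by (rule order_trans[rotated])
    then show "ereal (\<Sum>i\<in>{1..<n}. \<bar>w (t i) - w (t (i - 1))\<bar>) \<le> total_variation w a y - ereal \<bar>w y - w x\<bar>"
      by (simp add: ereal_le_minus)
  qed
  then show ?thesis by (simp add: ereal_le_minus)
qed

text \<open>\<open>V x\<close> is the variation of \<open>w\<close> on \<open>[a;x]\<close>. The
  step from \<open>x\<close> to \<open>b\<close> shows that it is finite, and the step from
  \<open>x\<close> to \<open>y\<close> gives the domination.\<close>

lemma var_dom_total_variation:
  assumes "a \<le> b" and fin: "total_variation w a b < \<infinity>"
  obtains V where "var_dom a b w V" "ereal (V b - V a) \<le> total_variation w a b"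
proof -
  define V where "V x = real_of_ereal (total_variation w a x)" for x
  have V: "total_variation w a x = ereal (V x)" if "a \<le> x" "x \<le> b" for x
  proof -
    have "total_variation w a x + ereal \<bar>w b - w x\<bar> \<le> total_variation w a b"
      using total_variation_step that by blast
    then have "total_variation w a x \<noteq> \<infinity>" using fin by auto
    then show ?thesis using total_variation_nonneg[of w a x] unfolding V_def
      by (metis abs_ereal_ge0 ereal_real)
  qed
  have "var_dom a b w V"
    unfolding var_dom_def
  proof (intro allI impI)
    fix x y assume h: "a \<le> x" "x \<le> y" "y \<le> b"
    show "\<bar>w y - w x\<bar> \<le> V y - V x"
      using total_variation_step[of a x y w] V[of x] V[of y] h by simp
  qed
  moreover have "0 \<le> V a" unfolding V_def by (simp add: real_of_ereal_pos total_variation_nonneg)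
  then have "ereal (V b - V a) \<le> total_variation w a b" using V[of b] assms by simp
  ultimately show ?thesis using that by blast
qed

section \<open>Normalised Riemann sums on blocks\<close>

text \<open>This is the Riemann sum of \<open>w\<close> against \<open>h\<close> minus
  \<open>w (q 0) * (h (q n) - h (q 0))\<close>.\<close>

definition block_sum :: "(real \<Rightarrow> real) \<Rightarrow> (real \<Rightarrow> real) \<Rightarrow> nat \<Rightarrow> (nat \<Rightarrow> real) \<Rightarrow> (nat \<Rightarrow> real) \<Rightarrow> real" where
  "block_sum w h n q \<nu> = (\<Sum>j<n. (w (\<nu> j) - w (q 0)) * (h (q (Suc j)) - h (q j)))"

text \<open>Monotonicity of \<open>q\<close> follows from the tags lying between consecutive points;
  repeated points are allowed.\<close>

definition tagged :: "real \<Rightarrow> real \<Rightarrow> nat \<Rightarrow> (nat \<Rightarrow> real) \<Rightarrow> (nat \<Rightarrow> real) \<Rightarrow> bool" where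
  "tagged c d n q \<nu> \<longleftrightarrow> q 0 = c \<and> q n = d \<and> (\<forall>j<n. q j \<le> \<nu> j \<and> \<nu> j \<le> q (Suc j))"

lemma tagged_mono:
  assumes "tagged c d n q \<nu>" "i \<le> j" "j \<le> n"
  shows "q i \<le> q j"
  using assms(2,3)
proof (induction j)
  case (Suc j)
  have "q j \<le> q (Suc j)" using assms(1) Suc.prems unfolding tagged_def
    by (meson Suc_le_lessD order_trans)
  then show ?case using Suc by (cases "i = Suc j") auto
qed auto

lemma tagged_bounds:
  assumes "tagged c d n q \<nu>"
  shows "j \<le> n \<Longrightarrow> c \<le> q j" "j \<le> n \<Longrightarrow> q j \<le> d" "j < n \<Longrightarrow> c \<le> \<nu> j" "j < n \<Longrightarrow> \<nu> j \<le> d" "c \<le> d"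
proof -
  show 1: "c \<le> q j" if "j \<le> n" for j using tagged_mono[OF assms, of 0 j] that assms by (simp add: tagged_def)
  show 2: "q j \<le> d" if "j \<le> n" for j using tagged_mono[OF assms, of j n] that assms by (simp add: tagged_def)
  show "c \<le> \<nu> j" if "j < n" using 1[of j] assms that unfolding tagged_def by force
  show "\<nu> j \<le> d" if "j < n" using 2[of "Suc j"] assms that unfolding tagged_def by force
  show "c \<le> d" using 1[of n] assms by (simp add: tagged_def)
qed

lemma block_sum_diff_left:
  "block_sum (\<lambda>x. w x - w' x) h n q \<nu> = block_sum w h n q \<nu> - block_sum w' h n q \<nu>"
  unfolding block_sum_def sum_subtractf[symmetric] by (rule sum.cong) (auto simp: algebra_simps)

lemma block_sum_diff_right:
  "block_sum w (\<lambda>x. h x - h' x) n q \<nu> = block_sum w h n q \<nu> - block_sum w h' n q \<nu>"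
  unfolding block_sum_def sum_subtractf[symmetric] by (rule sum.cong) (auto simp: algebra_simps)

text \<open>Abel summation. \<open>case_nat (q 0) \<nu>\<close> is the tag sequence with the left
  end put in front, so the normalisation at \<open>q 0\<close> leaves no boundary term.\<close>

lemma block_sum_parts:
  "block_sum w h n q \<nu> =
    (\<Sum>j<n. (w (case_nat (q 0) \<nu> (Suc j)) - w (case_nat (q 0) \<nu> j)) * (h (q n) - h (q j)))"
proof (induction n)
  case (Suc n)
  let ?\<nu> = "case_nat (q 0) \<nu>"
  have tel: "(\<Sum>j<Suc n. w (?\<nu> (Suc j)) - w (?\<nu> j)) = w (\<nu> n) - w (q 0)"
    by (subst sum_lessThan_telescope) simp
  \<comment> \<open>Split \<open>h (q (Suc n)) - h (q j)\<close> at \<open>h (q n)\<close>: the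
    first part telescopes to the new summand, and in the second the term \<open>j = n\<close> is
    0.\<close>
  have "(\<Sum>j<Suc n. (w (?\<nu> (Suc j)) - w (?\<nu> j)) * (h (q (Suc n)) - h (q j)))
    = (\<Sum>j<Suc n. (w (?\<nu> (Suc j)) - w (?\<nu> j)) * (h (q (Suc n)) - h (q n)))
      + (\<Sum>j<Suc n. (w (?\<nu> (Suc j)) - w (?\<nu> j)) * (h (q n) - h (q j)))"
    unfolding sum.distrib[symmetric] by (rule sum.cong) (auto simp: algebra_simps)
  also have "\<dots> = (w (\<nu> n) - w (q 0)) * (h (q (Suc n)) - h (q n)) + block_sum w h n q \<nu>"
    unfolding sum_distrib_right[symmetric] tel using Suc.IH by simp
  finally show ?case by (simp add: block_sum_def)
qed (simp add: block_sum_def)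

lemma block_sum_bound_right:
  assumes t: "tagged c d n q \<nu>" and V: "var_dom c d h V"
    and w: "\<And>x. c \<le> x \<Longrightarrow> x \<le> d \<Longrightarrow> \<bar>w x - w c\<bar> \<le> E"
  shows "\<bar>block_sum w h n q \<nu>\<bar> \<le> E * (V d - V c)"
proof -
  note b = tagged_bounds[OF t]
  have q: "q 0 = c" "q n = d" using t by (auto simp: tagged_def)
  have E: "0 \<le> E" using w[of c] b(5) by simp
  have "\<bar>block_sum w h n q \<nu>\<bar> \<le> (\<Sum>j<n. \<bar>(w (\<nu> j) - w (q 0)) * (h (q (Suc j)) - h (q j))\<bar>)"
    unfolding block_sum_def by (rule sum_abs)
  also have "\<dots> \<le> (\<Sum>j<n. E * (V (q (Suc j)) - V (q j)))"
  proof (rule sum_mono)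
    fix j assume "j \<in> {..<n}"
    then have j: "j < n" by simp
    have "\<bar>w (\<nu> j) - w (q 0)\<bar> \<le> E" using w b j q by simp
    moreover have "\<bar>h (q (Suc j)) - h (q j)\<bar> \<le> V (q (Suc j)) - V (q j)"
      by (rule var_domD[OF V]) (use b j tagged_mono[OF t, of j "Suc j"] in auto)
    ultimately show "\<bar>(w (\<nu> j) - w (q 0)) * (h (q (Suc j)) - h (q j))\<bar> \<le> E * (V (q (Suc j)) - V (q j))"
      unfolding abs_mult using E by (intro mult_mono) auto
  qed
  also have "\<dots> = E * (V d - V c)"
    unfolding sum_distrib_left[symmetric] by (subst sum_lessThan_telescope) (simp add: q)
  finally show ?thesis .
qed

text \<open>After summation by parts the roles are exchanged: the increments of \<open>w\<close>
  along the tags are dominated by \<open>V\<close>, while \<open>h\<close> enters only through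
  differences from its value at the right end.\<close>

lemma block_sum_bound_left:
  assumes t: "tagged c d n q \<nu>" and V: "var_dom c d w V"
    and h: "\<And>x. c \<le> x \<Longrightarrow> x \<le> d \<Longrightarrow> \<bar>h d - h x\<bar> \<le> E"
  shows "\<bar>block_sum w h n q \<nu>\<bar> \<le> E * (V d - V c)"
proof -
  note b = tagged_bounds[OF t]
  have q: "q 0 = c" "q n = d" using t by (auto simp: tagged_def)
  have E: "0 \<le> E" using h[of d] b(5) by simp
  let ?\<nu> = "case_nat (q 0) \<nu>"
  have bn: "c \<le> ?\<nu> j \<and> ?\<nu> j \<le> d" if "j \<le> n" for j
    using that b q by (cases j) auto
  have mono: "?\<nu> j \<le> ?\<nu> (Suc j)" if "j < n" for j
  proof (cases j)
    case 0
    then show ?thesis using t that by (auto simp: tagged_def)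
  next
    case (Suc k)
    then have "\<nu> k \<le> q (Suc k)" "q (Suc k) \<le> \<nu> (Suc k)" using t that by (auto simp: tagged_def)
    then show ?thesis using Suc by simp
  qed
  have "\<bar>block_sum w h n q \<nu>\<bar> \<le> (\<Sum>j<n. \<bar>(w (?\<nu> (Suc j)) - w (?\<nu> j)) * (h (q n) - h (q j))\<bar>)"
    unfolding block_sum_parts by (rule sum_abs)
  also have "\<dots> \<le> (\<Sum>j<n. E * (V (?\<nu> (Suc j)) - V (?\<nu> j)))"
  proof (rule sum_mono)
    fix j assume "j \<in> {..<n}"
    then have j: "j < n" by simp
    have "\<bar>h (q n) - h (q j)\<bar> \<le> E" using h b j q by simp
    moreover have "\<bar>w (?\<nu> (Suc j)) - w (?\<nu> j)\<bar> \<le> V (?\<nu> (Suc j)) - V (?\<nu> j)"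
      by (rule var_domD[OF V]) (use bn[of j] bn[of "Suc j"] mono[of j] j in auto)
    ultimately show "\<bar>(w (?\<nu> (Suc j)) - w (?\<nu> j)) * (h (q n) - h (q j))\<bar> \<le> E * (V (?\<nu> (Suc j)) - V (?\<nu> j))"
      unfolding abs_mult using E by (subst mult.commute) (intro mult_mono, auto)
  qed
  also have "\<dots> = E * (V (?\<nu> n) - V c)"
    unfolding sum_distrib_left[symmetric] sum_lessThan_telescope[of "\<lambda>j. V (?\<nu> j)" n] by (simp add: q)
  \<comment> \<open>The last tag may lie before \<open>d\<close>; monotonicity of \<open>V\<close>
    covers the gap.\<close>
  also have "\<dots> \<le> E * (V d - V c)"
    using var_dom_mono[OF V, of "?\<nu> n" d] bn[of n] E by (intro mult_left_mono) auto
  finally show ?thesis .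
qed

section \<open>Sums over several blocks\<close>

text \<open>Two special cases drive the proof: a single block gives the deviation of a Riemann sum
  from \<open>f a * (g b - g a)\<close>, and the intervals of a partition, taken as blocks, compare
  its Riemann sum with that of a refinement.\<close>

definition blocks :: "real \<Rightarrow> real \<Rightarrow> nat \<Rightarrow> (nat \<Rightarrow> real) \<Rightarrow> (nat \<Rightarrow> nat) \<Rightarrow> (nat \<Rightarrow> nat \<Rightarrow> real) \<Rightarrow> (nat \<Rightarrow> nat \<Rightarrow> real) \<Rightarrow> bool" where
  "blocks a b l p n q \<nu> \<longleftrightarrow> p 0 = a \<and> p l = b \<and> (\<forall>i<l. tagged (p i) (p (Suc i)) (n i) (q i) (\<nu> i))"

definition blocks_sum where
  "blocks_sum w h l n q \<nu> = (\<Sum>i<l. block_sum w h (n i) (q i) (\<nu> i))"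

lemma blocks_bounds:
  assumes "blocks a b l p n q \<nu>"
  shows "i < l \<Longrightarrow> a \<le> p i" "i < l \<Longrightarrow> p i \<le> p (Suc i)" "i < l \<Longrightarrow> p (Suc i) \<le> b"
proof -
  \<comment> \<open>The block ends form a tagged partition themselves, with left ends as
    tags.\<close>
  have t: "tagged a b l p p"
    using assms tagged_bounds(5) unfolding blocks_def tagged_def[of a b] by fastforce
  show "i < l \<Longrightarrow> a \<le> p i" "i < l \<Longrightarrow> p (Suc i) \<le> b"
    using tagged_bounds(1,2)[OF t] by auto
  show "i < l \<Longrightarrow> p i \<le> p (Suc i)" using t by (auto simp: tagged_def)
qed

lemma var_dom_subset: "var_dom a b w V \<Longrightarrow> a \<le> c \<Longrightarrow> d \<le> b \<Longrightarrow> var_dom c d w V"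
  unfolding var_dom_def by auto

lemma blocks_sum_le_telescope:
  fixes V :: "real \<Rightarrow> real"
  assumes B: "blocks a b l p n q \<nu>"
    and "\<And>i. i < l \<Longrightarrow> \<bar>z i\<bar> \<le> E * (V (p (Suc i)) - V (p i))"
  shows "\<bar>\<Sum>i<l. z i\<bar> \<le> E * (V b - V a)"
proof -
  have "\<bar>\<Sum>i<l. z i\<bar> \<le> (\<Sum>i<l. E * (V (p (Suc i)) - V (p i)))"
    by (rule order_trans[OF sum_abs], rule sum_mono) (use assms in auto)
  also have "\<dots> = E * (V b - V a)"
    unfolding sum_distrib_left[symmetric] sum_lessThan_telescope[of "\<lambda>i. V (p i)" l] using B by (simp add: blocks_def)
  finally show ?thesis .
qed

text \<open>For \<open>E = 0\<close> and infinite variation the right-hand side below is \<open>0\<close>, since \<open>0 * \<infinity> = 0\<close> in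
  \<^typ>\<open>ereal\<close>; the bound is still true because \<open>h\<close> is then constant on every block.\<close>

lemma blocks_sum_left_TV:
  assumes ab: "a \<le> b" and B: "blocks a b l p n q \<nu>" and E: "0 \<le> E"
    and h: "\<And>i x. i < l \<Longrightarrow> p i \<le> x \<Longrightarrow> x \<le> p (Suc i) \<Longrightarrow> \<bar>h (p (Suc i)) - h x\<bar> \<le> E"
  shows "ereal \<bar>blocks_sum w h l n q \<nu>\<bar> \<le> ereal E * total_variation w a b"
proof (cases "total_variation w a b < \<infinity>")
  case True
  then obtain V where V: "var_dom a b w V" "ereal (V b - V a) \<le> total_variation w a b"
    using var_dom_total_variation ab by blast
  have "\<bar>blocks_sum w h l n q \<nu>\<bar> \<le> E * (V b - V a)"
    unfolding blocks_sum_def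
  proof (rule blocks_sum_le_telescope[OF B])
    fix i assume i: "i < l"
    show "\<bar>block_sum w h (n i) (q i) (\<nu> i)\<bar> \<le> E * (V (p (Suc i)) - V (p i))"
      by (rule block_sum_bound_left)
        (use i h B V(1) blocks_bounds[OF B i] in \<open>auto simp: blocks_def intro: var_dom_subset\<close>)
  qed
  then have "ereal \<bar>blocks_sum w h l n q \<nu>\<bar> \<le> ereal E * ereal (V b - V a)" by simp
  also have "\<dots> \<le> ereal E * total_variation w a b"
    using V(2) E by (intro ereal_mult_left_mono) auto
  finally show ?thesis .
next
  case False
  then have inf: "total_variation w a b = \<infinity>" by simp
  show ?thesis
  proof (cases "E = 0")
    case True
    have "block_sum w h (n i) (q i) (\<nu> i) = 0" if i: "i < l" for i
    proof -
      have t: "tagged (p i) (p (Suc i)) (n i) (q i) (\<nu> i)" using B i by (simp add: blocks_def)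
      have "h (q i j) = h (p (Suc i))" if "j \<le> n i" for j
        using h[OF i, of "q i j"] tagged_bounds(1,2)[OF t that] True by simp
      then show ?thesis unfolding block_sum_def by simp
    qed
    then show ?thesis using True by (simp add: blocks_sum_def zero_ereal_def[symmetric])
  qed (use E inf in auto)
qed

text \<open>Counterpart of \<open>blocks_sum_left_TV\<close> without summation by parts. For
  \<open>E = 0\<close> and infinite variation it is now \<open>w\<close> that is constant on every
  block, so all summands vanish.\<close>

lemma blocks_sum_right_TV:
  assumes ab: "a \<le> b" and B: "blocks a b l p n q \<nu>" and E: "0 \<le> E"
    and w: "\<And>i x. i < l \<Longrightarrow> p i \<le> x \<Longrightarrow> x \<le> p (Suc i) \<Longrightarrow> \<bar>w x - w (p i)\<bar> \<le> E"
  shows "ereal \<bar>blocks_sum w h l n q \<nu>\<bar> \<le> ereal E * total_variation h a b"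
proof (cases "total_variation h a b < \<infinity>")
  case True
  then obtain V where V: "var_dom a b h V" "ereal (V b - V a) \<le> total_variation h a b"
    using var_dom_total_variation ab by blast
  have "\<bar>blocks_sum w h l n q \<nu>\<bar> \<le> E * (V b - V a)"
    unfolding blocks_sum_def
  proof (rule blocks_sum_le_telescope[OF B])
    fix i assume i: "i < l"
    show "\<bar>block_sum w h (n i) (q i) (\<nu> i)\<bar> \<le> E * (V (p (Suc i)) - V (p i))"
      by (rule block_sum_bound_right)
        (use i w B V(1) blocks_bounds[OF B i] in \<open>auto simp: blocks_def intro: var_dom_subset\<close>)
  qed
  then have "ereal \<bar>blocks_sum w h l n q \<nu>\<bar> \<le> ereal E * ereal (V b - V a)" by simp
  also have "\<dots> \<le> ereal E * total_variation h a b"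
    using V(2) E by (intro ereal_mult_left_mono) auto
  finally show ?thesis .
next
  case False
  then have inf: "total_variation h a b = \<infinity>" by simp
  show ?thesis
  proof (cases "E = 0")
    case True
    have "block_sum w h (n i) (q i) (\<nu> i) = 0" if i: "i < l" for i
    proof -
      have t: "tagged (p i) (p (Suc i)) (n i) (q i) (\<nu> i)" using B i by (simp add: blocks_def)
      have "w (\<nu> i j) = w (q i 0)" if "j < n i" for j
        using w[OF i, of "\<nu> i j"] tagged_bounds(3,4)[OF t that] True t by (simp add: tagged_def)
      then show ?thesis unfolding block_sum_def by simp
    qed
    then show ?thesis using True by (simp add: blocks_sum_def zero_ereal_def[symmetric])
  qed (use E inf in auto)
qed

section \<open>Regulated functions and small oscillation\<close>

text \<open>At \<open>x = a\<close> no \<open>t\<close> qualifies, so arbitrary values serve;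
  elsewhere \<open>L\<close> is the left limit.\<close>

lemma regulated_on_left:
  assumes "regulated_on a b h" "a \<le> x" "x \<le> b" "0 < \<delta>"
  shows "\<exists>L r. 0 < r \<and> (\<forall>t. a \<le> t \<longrightarrow> x - r < t \<longrightarrow> t < x \<longrightarrow> \<bar>h t - L\<bar> \<le> \<delta>)"
proof (cases "x = a")
  case True
  then show ?thesis by (intro exI[of _ 0] exI[of _ 1]) auto
next
  case False
  then obtain L where "(h \<longlongrightarrow> L) (at_left x)"
    using assms unfolding regulated_on_def by (cases "x = b") force+
  then have "eventually (\<lambda>t. dist (h t) L < \<delta>) (at_left x)"
    using assms(4) by (rule tendstoD)
  then obtain c where c: "c < x" "\<And>t. c < t \<Longrightarrow> t < x \<Longrightarrow> dist (h t) L < \<delta>"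
    unfolding eventually_at_left_field by blast
  show ?thesis
    by (intro exI[of _ L] exI[of _ "x - c"])
      (use c in \<open>auto simp: dist_real_def intro: less_imp_le\<close>)
qed

lemma regulated_on_right:
  assumes "regulated_on a b h" "a \<le> x" "x \<le> b" "0 < \<delta>"
  shows "\<exists>L r. 0 < r \<and> (\<forall>t. t \<le> b \<longrightarrow> x < t \<longrightarrow> t < x + r \<longrightarrow> \<bar>h t - L\<bar> \<le> \<delta>)"
proof (cases "x = b")
  case True
  then show ?thesis by (intro exI[of _ 0] exI[of _ 1]) auto
next
  case False
  then obtain L where "(h \<longlongrightarrow> L) (at_right x)"
    using assms unfolding regulated_on_def by (cases "x = a") force+
  then have "eventually (\<lambda>t. dist (h t) L < \<delta>) (at_right x)"
    using assms(4) by (rule tendstoD)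
  then obtain c where c: "x < c" "\<And>t. x < t \<Longrightarrow> t < c \<Longrightarrow> dist (h t) L < \<delta>"
    unfolding eventually_at_right_field by blast
  show ?thesis
    by (intro exI[of _ L] exI[of _ "c - x"])
      (use c in \<open>auto simp: dist_real_def intro: less_imp_le\<close>)
qed

text \<open>An increment across \<open>e\<close> splits at \<open>e\<close>; the jump
  \<open>\<bar>v e - u e\<bar>\<close> is charged once, just to the right of
  \<open>e\<close>.\<close>

lemma var_dom_glue:
  assumes u: "var_dom c e u U" and v: "var_dom e d v V" and ce: "c \<le> e" "e \<le> d"
  shows "var_dom c d (\<lambda>x. if x \<le> e then u x else v x)
    (\<lambda>x. if x \<le> e then U x else U e + \<bar>v e - u e\<bar> + (V x - V e))"
  unfolding var_dom_def
proof (intro allI impI)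
  fix x y assume h: "c \<le> x" "x \<le> y" "y \<le> d"
  show "\<bar>(if y \<le> e then u y else v y) - (if x \<le> e then u x else v x)\<bar>
    \<le> (if y \<le> e then U y else U e + \<bar>v e - u e\<bar> + (V y - V e))
      - (if x \<le> e then U x else U e + \<bar>v e - u e\<bar> + (V x - V e))"
  proof (cases "y \<le> e")
    case True
    then show ?thesis using var_domD[OF u, of x y] h by simp
  next
    case y: False
    show ?thesis
    proof (cases "x \<le> e")
      case True
      then show ?thesis using y h var_domD[OF u, of x e] var_domD[OF v, of e y] ce by simp
    next
      case False
      then show ?thesis using y h var_domD[OF v, of x y] by simp
    qed
  qed
qed

text \<open>Regulated functions are uniform limits of step functions. By bisection it suffices that
  approximability passes to adjoining intervals, which is gluing, and holds near every point, which
  follows from the one-sided limits.\<close>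

lemma regulated_approx:
  assumes reg: "regulated_on a b h" and ab: "a \<le> b" and \<delta>: "0 < \<delta>"
  obtains u V where "var_dom a b u V" "\<forall>t\<in>{a..b}. \<bar>h t - u t\<bar> \<le> \<delta>"
proof -
  define P where "P c d \<longleftrightarrow> (a \<le> c \<longrightarrow> d \<le> b \<longrightarrow> (\<exists>u V. var_dom c d u V \<and> (\<forall>t\<in>{c..d}. \<bar>h t - u t\<bar> \<le> \<delta>)))" for c d
  have "P a b" using ab
  proof (rule Bolzano)
    fix c e d assume P: "P c e" "P e d" and le: "c \<le> e" "e \<le> d"
    show "P c d" unfolding P_def
    proof (intro impI)
      assume h: "a \<le> c" "d \<le> b"
      obtain u U where u: "var_dom c e u U" "\<forall>t\<in>{c..e}. \<bar>h t - u t\<bar> \<le> \<delta>"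
        using P(1) h le unfolding P_def by force
      obtain v V where v: "var_dom e d v V" "\<forall>t\<in>{e..d}. \<bar>h t - v t\<bar> \<le> \<delta>"
        using P(2) h le unfolding P_def by force
      show "\<exists>u V. var_dom c d u V \<and> (\<forall>t\<in>{c..d}. \<bar>h t - u t\<bar> \<le> \<delta>)"
        by (rule exI, rule exI, rule conjI, rule var_dom_glue[OF u(1) v(1) le])
          (use u(2) v(2) in auto)
    qed
  next
    fix x assume x: "a \<le> x" "x \<le> b"
    obtain L r where L: "0 < r" "\<And>t. a \<le> t \<Longrightarrow> x - r < t \<Longrightarrow> t < x \<Longrightarrow> \<bar>h t - L\<bar> \<le> \<delta>"
      using regulated_on_left[OF reg x \<delta>] by blast
    obtain R s where R: "0 < s" "\<And>t. t \<le> b \<Longrightarrow> x < t \<Longrightarrow> t < x + s \<Longrightarrow> \<bar>h t - R\<bar> \<le> \<delta>"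
      using regulated_on_right[OF reg x \<delta>] by blast
    \<comment> \<open>A step function that keeps the exact value at \<open>x\<close>;
      \<open>?V\<close> accumulates its two jumps.\<close>
    let ?u = "\<lambda>t. if t < x then L else if t = x then h x else R"
    let ?V = "\<lambda>t. if t < x then 0 else if t = x then \<bar>h x - L\<bar> else \<bar>h x - L\<bar> + \<bar>R - h x\<bar>"
    have "P c d" if cd: "c \<le> x \<and> x \<le> d \<and> d - c < min r s" for c d
      unfolding P_def
    proof (rule impI, rule impI, rule exI[of _ ?u], rule exI[of _ ?V], rule conjI, rule_tac [2] ballI)
      assume h: "a \<le> c" "d \<le> b"
      show "var_dom c d ?u ?V" unfolding var_dom_def by auto
      fix t assume "t \<in> {c..d}"
      then show "\<bar>h t - ?u t\<bar> \<le> \<delta>" using L(2)[of t] R(2)[of t] cd h \<delta> by auto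
    qed
    then show "\<exists>d>0. \<forall>c e. c \<le> x \<and> x \<le> e \<and> e - c < d \<longrightarrow> P c e"
      using L(1) R(1) by (intro exI[of _ "min r s"]) auto
  qed
  then show ?thesis using that unfolding P_def by auto
qed

text \<open>Near each point one of the two functions is continuous and so oscillates little. A
  Lebesgue number of the resulting open cover is the required \<open>\<delta>\<close>; which
  function is tame depends on the interval.\<close>

lemma small_oscillation_cover:
  fixes f g :: "real \<Rightarrow> real"
  assumes cont: "\<forall>x\<in>{a..b}. continuous (at x within {a..b}) f \<or> continuous (at x within {a..b}) g"
    and \<epsilon>: "0 < \<epsilon>"
  obtains \<delta> where "0 < \<delta>"
    "\<And>c d. a \<le> c \<Longrightarrow> c \<le> d \<Longrightarrow> d \<le> b \<Longrightarrow> d - c < \<delta> \<Longrightarrow>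
      (\<forall>x\<in>{c..d}. \<forall>y\<in>{c..d}. \<bar>f x - f y\<bar> \<le> \<epsilon>) \<or> (\<forall>x\<in>{c..d}. \<forall>y\<in>{c..d}. \<bar>g x - g y\<bar> \<le> \<epsilon>)"
proof -
  define osc where "osc h U \<longleftrightarrow> (\<forall>x\<in>U \<inter> {a..b}. \<forall>y\<in>U \<inter> {a..b}. \<bar>h x - h y\<bar> \<le> \<epsilon>)"
    for h :: "real \<Rightarrow> real" and U
  have loc: "\<exists>r>0. osc h (ball x r)" if "continuous (at x within {a..b}) h" for h x
  proof -
    have "\<exists>r>0. \<forall>y\<in>{a..b}. dist y x < r \<longrightarrow> dist (h y) (h x) < \<epsilon> / 2"
      using that[unfolded continuous_within_eps_delta, THEN spec, THEN mp, OF half_gt_zero[OF \<epsilon>]] .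
    then obtain r where r: "r > 0" "\<And>y. y \<in> {a..b} \<Longrightarrow> dist y x < r \<Longrightarrow> dist (h y) (h x) < \<epsilon> / 2"
      by (elim exE conjE) blast
    have "osc h (ball x r)" unfolding osc_def
    proof (intro ballI)
      fix s t assume "s \<in> ball x r \<inter> {a..b}" "t \<in> ball x r \<inter> {a..b}"
      then have "dist (h s) (h x) < \<epsilon> / 2" "dist (h t) (h x) < \<epsilon> / 2"
        using r(2) by (auto simp: dist_commute)
      then show "\<bar>h s - h t\<bar> \<le> \<epsilon>" unfolding dist_real_def by linarith
    qed
    then show ?thesis using r(1) by blast
  qed
  define G where "G = {U. open U \<and> (osc f U \<or> osc g U)}"
  have "{a..b} \<subseteq> \<Union>G"
  proof
    fix x assume "x \<in> {a..b}"
    then obtain r where "r > 0" "osc f (ball x r) \<or> osc g (ball x r)" using cont loc by blast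
    then show "x \<in> \<Union>G" unfolding G_def by (intro UnionI[of "ball x r"]) auto
  qed
  then obtain \<delta> where \<delta>: "0 < \<delta>" "\<And>x. x \<in> {a..b} \<Longrightarrow> \<exists>U\<in>G. ball x \<delta> \<subseteq> U"
    using Heine_Borel_lemma[of "{a..b}" G] unfolding G_def by (metis (no_types, lifting) compact_Icc mem_Collect_eq)
  show ?thesis
  proof (rule that[OF \<delta>(1)])
    fix c d assume h: "a \<le> c" "c \<le> d" "d \<le> b" "d - c < \<delta>"
    then obtain U where U: "U \<in> G" "ball c \<delta> \<subseteq> U" using \<delta>(2)[of c] by auto
    have "{c..d} \<subseteq> U \<inter> {a..b}" using h U(2) by (force simp: dist_real_def)
    then show "(\<forall>x\<in>{c..d}. \<forall>y\<in>{c..d}. \<bar>f x - f y\<bar> \<le> \<epsilon>) \<or> (\<forall>x\<in>{c..d}. \<forall>y\<in>{c..d}. \<bar>g x - g y\<bar> \<le> \<epsilon>)"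
      using U(1) unfolding G_def osc_def by blast
  qed
qed

section \<open>Smallness of blockwise sums on fine blocks\<close>

text \<open>Removing \<open>D(f - u, g - v)\<close> from \<open>D(f, g)\<close> leaves
  \<open>D(f, v) + D(u, g - v)\<close>, or equally \<open>D(u, g) + D(f - u, v)\<close>. The first
  form suits blocks where \<open>f\<close> oscillates little, the second those where
  \<open>g\<close> does. The four \<open>\<epsilon>\<close> come from the oscillation, from
  \<open>\<eta>\<close>, from \<open>\<theta>\<close> and from the remainder.\<close>

lemma blocks_sum_small:
  assumes ab: "a \<le> b"
    and cont: "\<forall>x\<in>{a..b}. continuous (at x within {a..b}) f \<or> continuous (at x within {a..b}) g"
    and \<epsilon>: "0 < \<epsilon>" and u: "var_dom a b u U" and v: "var_dom a b v V"
    and fu: "\<And>x y. x \<in> {a..b} \<Longrightarrow> y \<in> {a..b} \<Longrightarrow> \<bar>(f x - u x) - (f y - u y)\<bar> \<le> \<eta>"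
    and gv: "\<And>x y. x \<in> {a..b} \<Longrightarrow> y \<in> {a..b} \<Longrightarrow> \<bar>(g x - v x) - (g y - v y)\<bar> \<le> \<theta>"
    and \<eta>: "\<eta> * (V b - V a) \<le> \<epsilon>" and \<theta>: "\<theta> * (U b - U a) \<le> \<epsilon>"
    and rem: "\<And>l p n q \<nu>. blocks a b l p n q \<nu> \<Longrightarrow>
      \<bar>blocks_sum (\<lambda>x. f x - u x) (\<lambda>x. g x - v x) l n q \<nu>\<bar> \<le> \<epsilon>"
  shows "\<exists>\<delta>>0. \<forall>l p n q \<nu>. blocks a b l p n q \<nu> \<longrightarrow> (\<forall>i<l. p (Suc i) - p i < \<delta>) \<longrightarrow>
    \<bar>blocks_sum f g l n q \<nu>\<bar> \<le> 4 * \<epsilon>"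
proof -
  have UV: "U a \<le> U b" "V a \<le> V b" using var_dom_mono u v ab by blast+
  define A where "A = (U b - U a) + (V b - V a)"
  have A: "0 \<le> A" using UV by (simp add: A_def)
  \<comment> \<open>The summand 1 keeps the quotient meaningful when both variations are 0.\<close>
  define \<epsilon>' where "\<epsilon>' = \<epsilon> / (A + 1)"
  have \<epsilon>': "0 < \<epsilon>'" "\<epsilon>' * A \<le> \<epsilon>" using A \<epsilon> by (auto simp: \<epsilon>'_def field_simps)
  have \<eta>0: "0 \<le> \<eta>" and \<theta>0: "0 \<le> \<theta>" using fu[of a a] gv[of a a] ab by auto
  obtain \<delta> where \<delta>: "0 < \<delta>" and osc: "\<And>c d. a \<le> c \<Longrightarrow> c \<le> d \<Longrightarrow> d \<le> b \<Longrightarrow> d - c < \<delta> \<Longrightarrow>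
      (\<forall>x\<in>{c..d}. \<forall>y\<in>{c..d}. \<bar>f x - f y\<bar> \<le> \<epsilon>') \<or> (\<forall>x\<in>{c..d}. \<forall>y\<in>{c..d}. \<bar>g x - g y\<bar> \<le> \<epsilon>')"
    using small_oscillation_cover[OF cont \<epsilon>'(1)] by blast
  \<comment> \<open>Increments of \<open>W\<close> dominate the bound of either case, so the sum
    telescopes however the two kinds of block alternate.\<close>
  define W where "W x = \<epsilon>' * (U x + V x) + \<eta> * V x + \<theta> * U x" for x
  have "\<bar>blocks_sum f g l n q \<nu>\<bar> \<le> 4 * \<epsilon>"
    if B: "blocks a b l p n q \<nu>" and mesh: "\<forall>i<l. p (Suc i) - p i < \<delta>" for l p n q \<nu>
  proof -
    let ?fu = "\<lambda>x. f x - u x" and ?gv = "\<lambda>x. g x - v x"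
    have step: "\<bar>block_sum f g (n i) (q i) (\<nu> i) - block_sum ?fu ?gv (n i) (q i) (\<nu> i)\<bar>
      \<le> 1 * (W (p (Suc i)) - W (p i))" if i: "i < l" for i
    proof -
      let ?K = "\<lambda>w h. block_sum w h (n i) (q i) (\<nu> i)"
      let ?c = "p i" and ?d = "p (Suc i)"
      note bd = blocks_bounds[OF B i]
      have t: "tagged ?c ?d (n i) (q i) (\<nu> i)" using B i by (simp add: blocks_def)
      have u': "var_dom ?c ?d u U" and v': "var_dom ?c ?d v V"
        using u v bd var_dom_subset by blast+
      have mono: "U ?c \<le> U ?d" "V ?c \<le> V ?d" using var_dom_mono u' v' bd by blast+
      have dU: "0 \<le> \<epsilon>' * (U ?d - U ?c)" "0 \<le> \<theta> * (U ?d - U ?c)"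
        and dV: "0 \<le> \<epsilon>' * (V ?d - V ?c)" "0 \<le> \<eta> * (V ?d - V ?c)"
        using mono \<epsilon>'(1) \<eta>0 \<theta>0 by auto
      have "\<bar>?K f g - ?K ?fu ?gv\<bar> \<le>
        \<epsilon>' * (U ?d - U ?c) + \<epsilon>' * (V ?d - V ?c) + \<eta> * (V ?d - V ?c) + \<theta> * (U ?d - U ?c)"
        using osc[OF bd mesh[rule_format, OF i]]
      proof
        assume o: "\<forall>x\<in>{?c..?d}. \<forall>y\<in>{?c..?d}. \<bar>f x - f y\<bar> \<le> \<epsilon>'"
        have "\<bar>?K f v\<bar> \<le> \<epsilon>' * (V ?d - V ?c)"
          by (rule block_sum_bound_right[OF t v']) (use o bd in auto)
        moreover have "\<bar>?K u ?gv\<bar> \<le> \<theta> * (U ?d - U ?c)"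
          by (rule block_sum_bound_left[OF t u']) (rule gv, use bd in auto)
        moreover have "?K f g - ?K ?fu ?gv = ?K f v + ?K u ?gv"
          by (simp add: block_sum_diff_left block_sum_diff_right)
        ultimately show ?thesis using dU dV by linarith
      next
        assume o: "\<forall>x\<in>{?c..?d}. \<forall>y\<in>{?c..?d}. \<bar>g x - g y\<bar> \<le> \<epsilon>'"
        have "\<bar>?K u g\<bar> \<le> \<epsilon>' * (U ?d - U ?c)"
          by (rule block_sum_bound_left[OF t u']) (use o bd in auto)
        moreover have "\<bar>?K ?fu v\<bar> \<le> \<eta> * (V ?d - V ?c)"
          by (rule block_sum_bound_right[OF t v']) (rule fu, use bd in auto)
        moreover have "?K f g - ?K ?fu ?gv = ?K u g + ?K ?fu v"
          by (simp add: block_sum_diff_left block_sum_diff_right)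
        ultimately show ?thesis using dU dV by linarith
      qed
      then show ?thesis by (simp add: W_def algebra_simps)
    qed
    have "\<bar>\<Sum>i<l. block_sum f g (n i) (q i) (\<nu> i) - block_sum ?fu ?gv (n i) (q i) (\<nu> i)\<bar> \<le> 1 * (W b - W a)"
      by (rule blocks_sum_le_telescope[OF B]) (rule step)
    then have "\<bar>blocks_sum f g l n q \<nu> - blocks_sum ?fu ?gv l n q \<nu>\<bar> \<le> W b - W a"
      by (simp add: blocks_sum_def sum_subtractf)
    moreover have "W b - W a = \<epsilon>' * A + \<eta> * (V b - V a) + \<theta> * (U b - U a)"
      by (simp add: W_def A_def algebra_simps)
    ultimately show ?thesis using rem[OF B] \<epsilon>'(2) \<eta> \<theta> by linarith
  qed
  then show ?thesis using \<delta> by blast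
qed

section \<open>The Cauchy criterion\<close>

lemma finite_set_enumeration:
  fixes Z :: "real set"
  assumes "finite Z" "a \<in> Z" "b \<in> Z" "Z \<subseteq> {a..b}"
  shows "\<exists>(m::nat) z. z ` {..m} = Z \<and> strict_mono_on {..m} z \<and> z 0 = a \<and> z m = b"
proof -
  let ?z = "\<lambda>j. sorted_list_of_set Z ! j"
  define m where "m = card Z - 1"
  have m: "card Z = Suc m" using assms(1,2) m_def by (metis Suc_pred' card_gt_0_iff empty_iff)
  have len: "length (sorted_list_of_set Z) = Suc m" using m by simp
  have img: "?z ` {..m} = Z"
  proof -
    have "set (sorted_list_of_set Z) = ?z ` {..<Suc m}"
      unfolding set_conv_nth len by auto
    then show ?thesis using assms(1) by (simp add: lessThan_Suc_atMost)
  qed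
  have sm: "strict_mono_on {..m} ?z"
    by (rule strict_mono_onI)
      (use sorted_wrt_nth_less[OF strict_sorted_list_of_set, of _ _ Z] len in auto)
  have mono: "?z i \<le> ?z j" if "i \<le> j" "j \<le> m" for i j
    using strict_mono_onD[OF sm, of i j] that by (cases "i = j") auto
  have "a \<in> ?z ` {..m}" "b \<in> ?z ` {..m}" unfolding img by fact+
  then obtain i j where "i \<le> m" "j \<le> m" "?z i = a" "?z j = b" by (elim imageE) auto
  moreover have "?z 0 \<in> ?z ` {..m}" "?z m \<in> ?z ` {..m}" by auto
  then have "a \<le> ?z 0" "?z m \<le> b" unfolding img using assms(4) by auto
  ultimately have "?z 0 = a" "?z m = b" using mono[of 0 i] mono[of j m] by auto
  then show ?thesis using img sm by (intro exI[of _ m] exI[of _ ?z]) simp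
qed

definition RS_sum where
  "RS_sum f g l p \<nu> = (\<Sum>i<l. f (\<nu> i) * (g (p (Suc i)) - g (p i)))" for f g :: "real \<Rightarrow> real"

lemma sum_regroup:
  fixes F :: "nat \<Rightarrow> real"
  assumes "s 0 = 0" "\<And>i. i < l \<Longrightarrow> s i \<le> s (Suc i)"
  shows "(\<Sum>j<s l. F j) = (\<Sum>i<l. \<Sum>j<s (Suc i) - s i. F (s i + j))"
  using assms(2)
proof (induction l)
  case (Suc l)
  have le: "s l \<le> s (Suc l)" using Suc.prems by simp
  have "(\<Sum>j<s (Suc l). F j) = (\<Sum>j<s l. F j) + (\<Sum>j<s (Suc l) - s l. F (s l + j))"
    using sum.atLeastLessThan_concat[of 0 "s l" "s (Suc l)" F] le sum.shift_bounds_nat_ivl[of F 0 "s l" "s (Suc l) - s l"]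
    by (simp add: lessThan_atLeast0 add.commute)
  then show ?case using Suc by simp
qed (simp add: assms(1))

text \<open>Both sums are compared with the sum over \<open>p\<close> tagged at left ends. Each
  difference is a blockwise normalised sum over the intervals of \<open>p\<close>, hence at most
  \<open>\<epsilon>\<close>.\<close>

lemma RS_sum_refinement:
  assumes small: "\<And>l p n q \<nu>. blocks a b l p n q \<nu> \<Longrightarrow> \<forall>i<l. p (Suc i) - p i < \<delta> \<Longrightarrow>
      \<bar>blocks_sum f g l n q \<nu>\<bar> \<le> \<epsilon>"
    and p: "p 0 = a" "p l = b" "\<forall>i<l. p i < p (Suc i)" "\<forall>i<l. p (Suc i) - p i < \<delta>"
    and \<nu>: "\<forall>i<l. p i \<le> \<nu> i \<and> \<nu> i \<le> p (Suc i)"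
    and z: "p ` {..l} \<subseteq> z ` {..m}" "strict_mono_on {..m} z" "z 0 = a" "z m = b"
  shows "\<bar>RS_sum f g l p \<nu> - RS_sum f g m z z\<bar> \<le> 2 * \<epsilon>"
proof -
  \<comment> \<open>\<open>s i\<close> will be the position of \<open>p i\<close> within the
    refinement.\<close>
  have "\<forall>i\<in>{..l}. \<exists>j\<le>m. z j = p i" using z(1) by force
  then obtain s where s: "\<And>i. i \<le> l \<Longrightarrow> s i \<le> m" "\<And>i. i \<le> l \<Longrightarrow> z (s i) = p i"
    by (metis atMost_iff)
  have inj: "i = j" if "z i = z j" "i \<le> m" "j \<le> m" for i j
    using strict_mono_on_imp_inj_on[OF z(2)] that by (auto simp: inj_on_def)
  have s0: "s 0 = 0" using inj[of "s 0" 0] s[of 0] p z by simp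
  have sl: "s l = m" using inj[of "s l" m] s[of l] p z by simp
  have sS: "s i \<le> s (Suc i)" if "i < l" for i
  proof (rule ccontr)
    assume "\<not> ?thesis"
    then have "z (s (Suc i)) < z (s i)"
      using strict_mono_onD[OF z(2), of "s (Suc i)" "s i"] s(1)[of i] that by auto
    then show False using s(2)[of i] s(2)[of "Suc i"] p(3) that by force
  qed
  have zmono: "z i \<le> z (Suc i)" if "i < m" for i
    using strict_mono_onD[OF z(2), of i "Suc i"] that by auto
  \<comment> \<open>First comparison: block \<open>i\<close> is subdivided by the points of
    \<open>z\<close> in it, tagged at their left ends.\<close>
  let ?n = "\<lambda>i. s (Suc i) - s i" and ?q = "\<lambda>i j. z (s i + j)"
  have B: "blocks a b l p ?n ?q ?q"
    unfolding blocks_def tagged_def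
  proof (intro conjI allI impI)
    fix i assume i: "i < l"
    show "z (s i + 0) = p i" "z (s i + (s (Suc i) - s i)) = p (Suc i)"
      using s(2)[of i] s(2)[of "Suc i"] sS[of i] i by auto
    fix j assume "j < s (Suc i) - s i"
    then show "z (s i + j) \<le> z (s i + j)" "z (s i + j) \<le> z (s i + Suc j)"
      using zmono[of "s i + j"] s(1)[of "Suc i"] i by auto
  qed (use p in auto)
  have "blocks_sum f g l ?n ?q ?q = RS_sum f g m z z - RS_sum f g l p p"
  proof -
    have blk: "block_sum f g (?n i) (?q i) (?q i) = (\<Sum>j<?n i. f (z (s i + j)) * (g (z (Suc (s i + j))) - g (z (s i + j))))
        - f (p i) * (g (p (Suc i)) - g (p i))" if i: "i < l" for i
    proof -
      have "(\<Sum>j<?n i. f (p i) * (g (z (s i + Suc j)) - g (z (s i + j)))) = f (p i) * (g (p (Suc i)) - g (p i))"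
        unfolding sum_distrib_left[symmetric] sum_lessThan_telescope[of "\<lambda>j. g (z (s i + j))" "?n i"]
        using s(2)[of i] s(2)[of "Suc i"] sS[of i] i by simp
      then show ?thesis using s(2)[of i] i
        by (simp add: block_sum_def left_diff_distrib sum_subtractf)
    qed
    have "RS_sum f g m z z = (\<Sum>i<l. \<Sum>j<?n i. f (z (s i + j)) * (g (z (Suc (s i + j))) - g (z (s i + j))))"
      unfolding RS_sum_def sl[symmetric] by (rule sum_regroup[OF s0 sS])
    then show ?thesis
      unfolding blocks_sum_def RS_sum_def[of f g l] sum_subtractf[symmetric]
      by (simp add: blk sum_subtractf)
  qed
  moreover have "\<bar>blocks_sum f g l ?n ?q ?q\<bar> \<le> \<epsilon>" using small[OF B] p(4) .
  moreover
  \<comment> \<open>Second comparison: each block is one undivided interval carrying the tag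
    \<open>\<nu> i\<close>.\<close>
  let ?q' = "\<lambda>i j. if j = 0 then p i else p (Suc i)"
  have B': "blocks a b l p (\<lambda>_. 1) ?q' (\<lambda>i _. \<nu> i)"
    unfolding blocks_def tagged_def using p \<nu> by auto
  have "blocks_sum f g l (\<lambda>_. 1) ?q' (\<lambda>i _. \<nu> i) = RS_sum f g l p \<nu> - RS_sum f g l p p"
    by (simp add: blocks_sum_def block_sum_def RS_sum_def left_diff_distrib sum_subtractf)
  moreover have "\<bar>blocks_sum f g l (\<lambda>_. 1) ?q' (\<lambda>i _. \<nu> i)\<bar> \<le> \<epsilon>" using small[OF B'] p(4) .
  ultimately show ?thesis by linarith
qed

text \<open>Both sums are within \<open>2 * \<epsilon>\<close> of the left-tagged sum over the
  common refinement, whose points are the union of the two point sets.\<close>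

lemma RS_sum_Cauchy:
  assumes small: "\<And>l p n q \<nu>. blocks a b l p n q \<nu> \<Longrightarrow> \<forall>i<l. p (Suc i) - p i < \<delta> \<Longrightarrow>
      \<bar>blocks_sum f g l n q \<nu>\<bar> \<le> \<epsilon>"
    and p: "p 0 = a" "p l = b" "\<forall>i<l. p i < p (Suc i)" "\<forall>i<l. p (Suc i) - p i < \<delta>"
    and \<nu>: "\<forall>i<l. p i \<le> \<nu> i \<and> \<nu> i \<le> p (Suc i)"
    and p': "p' 0 = a" "p' l' = b" "\<forall>i<l'. p' i < p' (Suc i)" "\<forall>i<l'. p' (Suc i) - p' i < \<delta>"
    and \<nu>': "\<forall>i<l'. p' i \<le> \<nu>' i \<and> \<nu>' i \<le> p' (Suc i)"
  shows "\<bar>RS_sum f g l p \<nu> - RS_sum f g l' p' \<nu>'\<bar> \<le> 4 * \<epsilon>"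
proof -
  have t: "tagged a b l p \<nu>" "tagged a b l' p' \<nu>'" using p \<nu> p' \<nu>' by (auto simp: tagged_def)
  let ?Z = "p ` {..l} \<union> p' ` {..l'}"
  have sub: "?Z \<subseteq> {a..b}" using tagged_bounds(1,2)[OF t(1)] tagged_bounds(1,2)[OF t(2)] by auto
  have ends: "a \<in> ?Z" "b \<in> ?Z" using p by force+
  have "finite ?Z" by simp
  then obtain m :: nat and z where z: "z ` {..m} = ?Z" "strict_mono_on {..m} z" "z 0 = a" "z m = b"
    using finite_set_enumeration[OF _ ends sub] by blast
  have "\<bar>RS_sum f g l p \<nu> - RS_sum f g m z z\<bar> \<le> 2 * \<epsilon>"
    by (rule RS_sum_refinement[OF small p \<nu> _ z(2-4)]) (use z in auto)
  moreover have "\<bar>RS_sum f g l' p' \<nu>' - RS_sum f g m z z\<bar> \<le> 2 * \<epsilon>"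
    by (rule RS_sum_refinement[OF small p' \<nu>' _ z(2-4)]) (use z in auto)
  ultimately show ?thesis by linarith
qed

text \<open>Left-tagged sums over uniform partitions form a Cauchy sequence; every sufficiently fine
  sum is close to them and therefore to their limit.\<close>

lemma RS_has_integral_exists:
  assumes ab: "a < b"
    and small: "\<And>\<epsilon>. 0 < \<epsilon> \<Longrightarrow> \<exists>\<delta>>0. \<forall>l p n q \<nu>. blocks a b l p n q \<nu> \<longrightarrow> (\<forall>i<l. p (Suc i) - p i < \<delta>) \<longrightarrow>
      \<bar>blocks_sum f g l n q \<nu>\<bar> \<le> \<epsilon>"
  obtains I where "RS_has_integral f g a b I"
proof -
  define u where "u N i = a + (b - a) * real i / real (Suc N)" for N i
  have u: "u N 0 = a" "u N (Suc N) = b" "u N i < u N (Suc i)" "u N (Suc i) - u N i = (b - a) / real (Suc N)" for N i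
  proof -
    show "u N 0 = a" by (simp add: u_def)
    have "(b - a) * real (Suc N) / real (Suc N) = b - a"
      by (rule nonzero_mult_div_cancel_right) (rule of_nat_neq_0)
    then show "u N (Suc N) = b" unfolding u_def by linarith
    show e: "u N (Suc i) - u N i = (b - a) / real (Suc N)"
      unfolding u_def of_nat_Suc[of i] by (simp add: distrib_left add_divide_distrib del: of_nat_Suc)
    have "0 < (b - a) / real (Suc N)" using ab by (simp del: of_nat_Suc)
    then show "u N i < u N (Suc i)" using e by linarith
  qed
  define R where "R N = RS_sum f g (Suc N) (u N) (u N)" for N
  have mesh: "\<exists>N0. \<forall>N\<ge>N0. \<forall>i. u N (Suc i) - u N i < \<delta>" if "0 < \<delta>" for \<delta>
  proof -
    have "(\<lambda>N. (b - a) / real (Suc N)) \<longlonglongrightarrow> 0"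
      using LIMSEQ_Suc[OF lim_const_over_n[of "b - a"]] .
    then have "eventually (\<lambda>N. (b - a) / real (Suc N) < \<delta>) sequentially"
      using that by (rule order_tendstoD)
    then show ?thesis unfolding u(4) eventually_sequentially by blast
  qed
  have close: "\<exists>\<delta>>0. (\<exists>N0. \<forall>N\<ge>N0. \<forall>l p \<nu>. p 0 = a \<longrightarrow> p l = b \<longrightarrow> (\<forall>i<l. p i < p (Suc i)) \<longrightarrow>
        (\<forall>i<l. p (Suc i) - p i < \<delta>) \<longrightarrow> (\<forall>i<l. p i \<le> \<nu> i \<and> \<nu> i \<le> p (Suc i)) \<longrightarrow>
        \<bar>RS_sum f g l p \<nu> - R N\<bar> < \<epsilon>) \<and> (\<exists>N0. \<forall>N\<ge>N0. \<forall>N'\<ge>N0. \<bar>R N' - R N\<bar> < \<epsilon>)" if \<epsilon>: "0 < \<epsilon>" for \<epsilon>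
  proof -
    \<comment> \<open>The comparison costs a factor 4, so one fifth yields a strict
      inequality.\<close>
    obtain \<delta> where \<delta>: "\<delta> > 0" and s: "\<And>l p n q \<nu>. blocks a b l p n q \<nu> \<Longrightarrow> \<forall>i<l. p (Suc i) - p i < \<delta> \<Longrightarrow>
      \<bar>blocks_sum f g l n q \<nu>\<bar> \<le> \<epsilon> / 5" using small[of "\<epsilon> / 5"] \<epsilon> by auto
    obtain N0 where N0: "\<And>N i. N \<ge> N0 \<Longrightarrow> u N (Suc i) - u N i < \<delta>" using mesh[OF \<delta>] by blast
    have 1: "\<bar>RS_sum f g l p \<nu> - R N\<bar> < \<epsilon>" if "p 0 = a" "p l = b" "\<forall>i<l. p i < p (Suc i)"
      "\<forall>i<l. p (Suc i) - p i < \<delta>" "\<forall>i<l. p i \<le> \<nu> i \<and> \<nu> i \<le> p (Suc i)" "N0 \<le> N" for l p \<nu> N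
    proof -
      have "\<bar>RS_sum f g l p \<nu> - R N\<bar> \<le> 4 * (\<epsilon> / 5)" unfolding R_def
        by (rule RS_sum_Cauchy[OF s that(1-5)]) (use u N0[OF that(6)] less_imp_le[OF u(3)] in auto)
      then show ?thesis using \<epsilon> by simp
    qed
    have 2: "\<bar>R N' - R N\<bar> < \<epsilon>" if "N0 \<le> N" "N0 \<le> N'" for N N'
      unfolding R_def[of N'] by (rule 1) (use u N0[OF that(2)] less_imp_le[OF u(3)] that in auto)
    show ?thesis using 1 2 \<delta> by blast
  qed
  have "Cauchy R"
  proof (rule metric_CauchyI)
    fix e :: real assume "0 < e"
    then obtain N0 where "\<forall>N\<ge>N0. \<forall>N'\<ge>N0. \<bar>R N' - R N\<bar> < e" using close by blast
    then show "\<exists>M. \<forall>m\<ge>M. \<forall>n\<ge>M. dist (R m) (R n) < e" by (auto simp: dist_real_def)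
  qed
  then obtain I where I: "R \<longlonglongrightarrow> I" using Cauchy_convergent convergent_def by blast
  have "RS_has_integral f g a b I"
    unfolding RS_has_integral_def RS_sum_def[symmetric]
  proof (intro allI impI)
    fix e :: real assume e: "0 < e"
    obtain \<delta> N0 where \<delta>: "\<delta> > 0" and c: "\<And>N l p \<nu>. N \<ge> N0 \<Longrightarrow> p 0 = a \<Longrightarrow> p l = b \<Longrightarrow> (\<forall>i<l. p i < p (Suc i)) \<Longrightarrow>
        (\<forall>i<l. p (Suc i) - p i < \<delta>) \<Longrightarrow> (\<forall>i<l. p i \<le> \<nu> i \<and> \<nu> i \<le> p (Suc i)) \<Longrightarrow>
        \<bar>RS_sum f g l p \<nu> - R N\<bar> < e / 2" using close[of "e / 2"] e by (metis half_gt_zero)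
    have "eventually (\<lambda>N. \<bar>R N - I\<bar> < e / 2) sequentially"
      using tendstoD[OF I, of "e / 2"] e by (simp add: dist_real_def)
    then obtain N where N: "N \<ge> N0" "\<bar>R N - I\<bar> < e / 2"
      unfolding eventually_sequentially by (meson linorder_linear)
    show "\<exists>\<delta>>0. \<forall>l p \<nu>. p 0 = a \<longrightarrow> p l = b \<longrightarrow> (\<forall>i<l. p i < p (Suc i)) \<longrightarrow> (\<forall>i<l. p (Suc i) - p i < \<delta>) \<longrightarrow>
      (\<forall>i<l. p i \<le> \<nu> i \<and> \<nu> i \<le> p (Suc i)) \<longrightarrow> \<bar>RS_sum f g l p \<nu> - I\<bar> < e"
    proof (intro exI[of _ \<delta>] conjI allI impI \<delta>)
      fix l p \<nu>
      assume "p 0 = a" "p l = b" "\<forall>i<l. p i < p (Suc i)" "\<forall>i<l. p (Suc i) - p i < \<delta>"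
        "\<forall>i<l. p i \<le> \<nu> i \<and> \<nu> i \<le> p (Suc i)"
      from c[OF N(1) this] N(2) show "\<bar>RS_sum f g l p \<nu> - I\<bar> < e" by linarith
    qed
  qed
  then show ?thesis by (rule that)
qed

text \<open>A single fine uniform partition has a sum close to \<open>I\<close> that also obeys the
  bound.\<close>

lemma RS_has_integral_bound:
  assumes I: "RS_has_integral f g a b I" and ab: "a < b"
    and bd: "\<And>l p \<nu>. tagged a b l p \<nu> \<Longrightarrow> \<bar>RS_sum f g l p \<nu> - c\<bar> \<le> C"
  shows "\<bar>I - c\<bar> \<le> C"
proof (rule field_le_epsilon)
  fix e :: real assume "0 < e"
  then obtain \<delta> where \<delta>: "\<delta> > 0" and c: "\<forall>l p \<nu>. p 0 = a \<longrightarrow> p l = b \<longrightarrow> (\<forall>i<l. p i < p (Suc i)) \<longrightarrow>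
        (\<forall>i<l. p (Suc i) - p i < \<delta>) \<longrightarrow> (\<forall>i<l. p i \<le> \<nu> i \<and> \<nu> i \<le> p (Suc i)) \<longrightarrow>
        \<bar>RS_sum f g l p \<nu> - I\<bar> < e"
    using I[unfolded RS_has_integral_def RS_sum_def[symmetric], rule_format, of e] by blast
  obtain N where N: "(b - a) / \<delta> < real N" using reals_Archimedean2 by blast
  have N0: "0 < N" using N \<delta> ab by (cases N) (auto simp: divide_less_0_iff field_simps)
  let ?p = "\<lambda>i. a + (b - a) * real i / real N"
  have d: "?p (Suc i) - ?p i = (b - a) / N" for i using N0 by (simp add: field_simps)
  have lt: "?p i < ?p (Suc i)" for i using d[of i] ab N0 by (smt (verit) divide_pos_pos of_nat_0_less_iff)
  have m: "(b - a) / N < \<delta>" using N N0 \<delta> by (simp add: field_simps)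
  have "\<bar>RS_sum f g N ?p ?p - I\<bar> < e"
    by (rule c[rule_format]) (use N0 lt less_imp_le[OF lt] m in \<open>simp_all only: d, auto\<close>)
  moreover have "\<bar>RS_sum f g N ?p ?p - c\<bar> \<le> C"
    by (rule bd) (use less_imp_le[OF lt] N0 in \<open>auto simp: tagged_def\<close>)
  ultimately show "\<bar>I - c\<bar> \<le> C + e" by linarith
qed

section \<open>Truncated variation and the telescoping estimate\<close>

lemma truncated_variation_antimono:
  assumes "\<delta> \<le> \<delta>'"
  shows "truncated_variation h a b \<delta>' \<le> truncated_variation h a b \<delta>"
  unfolding truncated_variation_def by (rule Inf_superset_mono) (use assms in fastforce)

lemma truncated_variation_nonneg: "0 \<le> truncated_variation h a b \<delta>"
  unfolding truncated_variation_def by (rule Inf_greatest) (auto simp: total_variation_nonneg)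

text \<open>If the infimum is infinite, \<open>h\<close> itself serves; otherwise this is the
  approximation property of a finite infimum.\<close>

lemma truncated_variation_approx:
  assumes "0 \<le> \<delta>" "0 < e"
  shows "\<exists>u. (\<forall>t\<in>{a..b}. \<bar>h t - u t\<bar> \<le> \<delta> / 2) \<and> total_variation u a b \<le> truncated_variation h a b \<delta> + ereal e"
proof (cases "truncated_variation h a b \<delta> = \<infinity>")
  case True
  then show ?thesis using assms by (intro exI[of _ h]) auto
next
  case False
  then have "truncated_variation h a b \<delta> < truncated_variation h a b \<delta> + ereal e"
    using truncated_variation_nonneg[of h a b \<delta>] assms(2)
    by (cases "truncated_variation h a b \<delta>") auto
  then obtain u where "\<forall>t\<in>{a..b}. \<bar>h t - u t\<bar> \<le> \<delta> / 2"
      "total_variation u a b < truncated_variation h a b \<delta> + ereal e"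
    by (subst (asm) (2) truncated_variation_def) (auto simp: Inf_less_iff truncated_variation_def[symmetric])
  then show ?thesis by (intro exI[of _ u]) (auto intro: less_imp_le)
qed

text \<open>At level 0 every competitor agrees with \<open>h\<close> on
  \<open>[a;b]\<close>.\<close>

lemma var_dom_truncated_variation_zero:
  assumes "a \<le> b" "truncated_variation h a b 0 < \<infinity>"
  shows "\<exists>V. var_dom a b h V"
proof -
  obtain u where u: "\<forall>t\<in>{a..b}. \<bar>h t - u t\<bar> \<le> 0 / 2" "total_variation u a b < \<infinity>"
    using assms(2) unfolding truncated_variation_def Inf_less_iff by auto
  obtain V where "var_dom a b u V" using var_dom_total_variation[OF assms(1) u(2)] by blast
  then have "var_dom a b h V" using u(1) unfolding var_dom_def by auto
  then show ?thesis by blast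
qed

text \<open>The index is shifted: \<open>U (Suc k)\<close> belongs to \<open>\<delta> k\<close>, and \<open>U 0 = 0\<close> makes the estimate with
  \<open>\<theta>\<close> at index \<open>-1\<close> a step of the same recursion.\<close>

definition approximants ::
  "real \<Rightarrow> real \<Rightarrow> (real \<Rightarrow> real) \<Rightarrow> (nat \<Rightarrow> real) \<Rightarrow> real \<Rightarrow> (nat \<Rightarrow> real \<Rightarrow> real) \<Rightarrow> bool" where
  "approximants a b h \<delta> c U \<longleftrightarrow> U 0 = (\<lambda>_. 0) \<and>
    (\<forall>k. \<forall>t\<in>{a..b}. \<bar>h t - U (Suc k) t\<bar> \<le> \<delta> k / 2) \<and>
    (\<forall>k. total_variation (U (Suc k)) a b \<le> truncated_variation h a b (\<delta> k) + ereal c) \<and>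
    (\<forall>k. total_variation (\<lambda>x. U (Suc k) x - U k x) a b
      \<le> ereal (2 ^ k) * (truncated_variation h a b (\<delta> k) + ereal (4 * c / 4 ^ k)))"

lemma approximantsD:
  assumes "approximants a b h \<delta> c U"
  shows "U 0 = (\<lambda>_. 0)"
    "\<And>k t. t \<in> {a..b} \<Longrightarrow> \<bar>h t - U (Suc k) t\<bar> \<le> \<delta> k / 2"
    "\<And>k. total_variation (U (Suc k)) a b \<le> truncated_variation h a b (\<delta> k) + ereal c"
    "\<And>k. total_variation (\<lambda>x. U (Suc k) x - U k x) a b
      \<le> ereal (2 ^ k) * (truncated_variation h a b (\<delta> k) + ereal (4 * c / 4 ^ k))"
  using assms unfolding approximants_def by auto

text \<open>Since \<open>\<delta>\<close> is decreasing, the variation of an increment is at most twice the later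
  truncated variation, up to the error.\<close>

lemma approximants_exist:
  assumes dec: "decseq \<delta>" and \<delta>: "\<forall>k. 0 \<le> \<delta> k" and c: "0 < c"
  shows "\<exists>U. approximants a b h \<delta> c U"
proof -
  let ?T = "\<lambda>k. truncated_variation h a b (\<delta> k)"
  \<comment> \<open>The errors decay like \<open>4 ^ k\<close> so that they remain summable under
    the weights \<open>2 ^ k\<close>.\<close>
  have "\<exists>u. \<forall>k. (\<forall>t\<in>{a..b}. \<bar>h t - u k t\<bar> \<le> \<delta> k / 2) \<and> total_variation (u k) a b \<le> ?T k + ereal (c / 4 ^ k)"
    by (rule choice, intro allI truncated_variation_approx) (use \<delta> c in auto)
  then obtain u where u: "\<And>k t. t \<in> {a..b} \<Longrightarrow> \<bar>h t - u k t\<bar> \<le> \<delta> k / 2"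
    and TV: "\<And>k. total_variation (u k) a b \<le> ?T k + ereal (c / 4 ^ k)" by blast
  have T0: "0 \<le> ?T k" for k by (rule truncated_variation_nonneg)
  have inc: "total_variation (\<lambda>x. case_nat (\<lambda>_. 0) u (Suc k) x - case_nat (\<lambda>_. 0) u k x) a b
      \<le> ereal (2 ^ k) * (?T k + ereal (4 * c / 4 ^ k))" for k
  proof (cases k)
    case 0
    have "total_variation (u 0) a b \<le> ?T 0 + ereal c" using TV[of 0] by simp
    also have "\<dots> \<le> ?T 0 + ereal (4 * c)" using c by (intro add_left_mono) auto
    finally show ?thesis using 0 by (simp add: one_ereal_def[symmetric])
  next
    case (Suc j)
    have "total_variation (\<lambda>x. u k x - u j x) a b \<le> total_variation (u k) a b + total_variation (u j) a b"
      by (rule total_variation_diff)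
    also have "\<dots> \<le> (?T k + ereal (c / 4 ^ k)) + (?T j + ereal (c / 4 ^ j))"
      by (intro add_mono TV)
    also have "?T j \<le> ?T k" using dec Suc by (intro truncated_variation_antimono) (simp add: decseq_Suc_iff)
    finally have "total_variation (\<lambda>x. u k x - u j x) a b \<le> (?T k + ereal (c / 4 ^ k)) + (?T k + ereal (c / 4 ^ j))"
      by (meson add_left_mono add_right_mono order_trans)
    also have "\<dots> \<le> (?T k + ereal (4 * c / 4 ^ k)) + (?T k + ereal (4 * c / 4 ^ k))"
      using c Suc by (intro add_mono add_left_mono order_refl) (auto simp: field_simps)
    also have "\<dots> = ereal 2 * (?T k + ereal (4 * c / 4 ^ k))"
      using T0[of k] by (cases "?T k") auto
    \<comment> \<open>Here \<open>k\<close> is a successor, so the factor 2 is at most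
      \<open>2 ^ k\<close>, the weight in the series.\<close>
    also have "\<dots> \<le> ereal (2 ^ k) * (?T k + ereal (4 * c / 4 ^ k))"
    proof (rule ereal_mult_right_mono)
      show "ereal 2 \<le> ereal (2 ^ k)" using Suc by simp
      show "0 \<le> ?T k + ereal (4 * c / 4 ^ k)" using T0[of k] c by (intro add_nonneg_nonneg) auto
    qed
    finally show ?thesis using Suc by simp
  qed
  have TV': "total_variation (u k) a b \<le> ?T k + ereal c" for k
  proof -
    have "c / 4 ^ k \<le> c / 1" using c by (intro divide_left_mono) auto
    then have "?T k + ereal (c / 4 ^ k) \<le> ?T k + ereal c" by (intro add_left_mono) simp
    then show ?thesis using TV[of k] by (rule order_trans[rotated])
  qed
  have "approximants a b h \<delta> c (case_nat (\<lambda>_. 0) u)"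
    unfolding approximants_def
  proof (intro conjI allI ballI)
    fix k t assume "t \<in> {a..b}"
    then show "\<bar>h t - case_nat (\<lambda>_. 0) u (Suc k) t\<bar> \<le> \<delta> k / 2" using u[of t k] by (simp only: nat.case)
  qed (use TV' inc in \<open>simp_all only: nat.case\<close>)
  then show ?thesis by (intro exI)
qed

section \<open>Telescoping along the approximants\<close>

lemma blocks_sum_diff_left:
  "blocks_sum (\<lambda>x. w x - w' x) h l n q \<nu> = blocks_sum w h l n q \<nu> - blocks_sum w' h l n q \<nu>"
  unfolding blocks_sum_def by (simp add: block_sum_diff_left sum_subtractf)

lemma blocks_sum_diff_right:
  "blocks_sum w (\<lambda>x. h x - h' x) l n q \<nu> = blocks_sum w h l n q \<nu> - blocks_sum w h' l n q \<nu>"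
  unfolding blocks_sum_def by (simp add: block_sum_diff_right sum_subtractf)

text \<open>The bound grows with the number of intervals, but for fixed blocks it tends to 0 with
  \<open>E\<close>.\<close>

lemma blocks_sum_crude:
  assumes B: "blocks a b l p n q \<nu>"
    and w: "\<And>i x. i < l \<Longrightarrow> p i \<le> x \<Longrightarrow> x \<le> p (Suc i) \<Longrightarrow> \<bar>w x - w (p i)\<bar> \<le> E"
    and h: "\<And>i x. i < l \<Longrightarrow> p i \<le> x \<Longrightarrow> x \<le> p (Suc i) \<Longrightarrow> \<bar>h (p (Suc i)) - h x\<bar> \<le> C"
  shows "\<bar>blocks_sum w h l n q \<nu>\<bar> \<le> (\<Sum>i<l. \<Sum>j<n i. E * (2 * C))"
  unfolding blocks_sum_def block_sum_def
proof (rule order_trans[OF sum_abs], rule sum_mono, rule order_trans[OF sum_abs], rule sum_mono)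
  fix i j assume "i \<in> {..<l}" "j \<in> {..<n i}"
  then have i: "i < l" and j: "j < n i" by auto
  have t: "tagged (p i) (p (Suc i)) (n i) (q i) (\<nu> i)" using B i by (simp add: blocks_def)
  note b = tagged_bounds[OF t]
  have "\<bar>w (\<nu> i j) - w (q i 0)\<bar> \<le> E" using w[OF i b(3,4)[OF j]] t by (simp add: tagged_def)
  moreover have "\<bar>h (q i (Suc j)) - h (q i j)\<bar> \<le> 2 * C"
    using h[OF i, of "q i j"] h[OF i, of "q i (Suc j)"] b(1,2)[of j] b(1,2)[of "Suc j"] j by auto
  ultimately show "\<bar>(w (\<nu> i j) - w (q i 0)) * (h (q i (Suc j)) - h (q i j))\<bar> \<le> E * (2 * C)"
    unfolding abs_mult by (intro mult_mono) auto
qed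

text \<open>\<open>\<eta> k\<close> controls \<open>f - U (Suc k)\<close> while
  \<open>\<Theta> k\<close> controls \<open>g - V k\<close>: in each step \<open>U\<close> advances
  before \<open>V\<close>. After finitely many steps the leftover \<open>D\<close> is removed by the
  crude bound.\<close>

lemma blocks_sum_tail:
  fixes U V :: "nat \<Rightarrow> real \<Rightarrow> real"
  assumes ab: "a \<le> b" and B: "blocks a b l p n q \<nu>"
    and fU: "\<And>k i x. N \<le> k \<Longrightarrow> i < l \<Longrightarrow> p i \<le> x \<Longrightarrow> x \<le> p (Suc i) \<Longrightarrow>
      \<bar>(f x - U (Suc k) x) - (f (p i) - U (Suc k) (p i))\<bar> \<le> \<eta> k"
    and gV: "\<And>k i x. N \<le> k \<Longrightarrow> i < l \<Longrightarrow> p i \<le> x \<Longrightarrow> x \<le> p (Suc i) \<Longrightarrow>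
      \<bar>(g (p (Suc i)) - V k (p (Suc i))) - (g x - V k x)\<bar> \<le> \<Theta> k"
    and \<eta>: "\<And>k. 0 \<le> \<eta> k" "\<eta> \<longlonglongrightarrow> 0" and \<Theta>: "\<And>k. 0 \<le> \<Theta> k" "\<And>k. \<Theta> k \<le> C"
    and \<gamma>: "\<And>k. N \<le> k \<Longrightarrow> ereal (\<Theta> k) * total_variation (\<lambda>x. U (Suc k) x - U k x) a b
      + ereal (\<eta> k) * total_variation (\<lambda>x. V (Suc k) x - V k x) a b \<le> ereal (\<gamma> k)"
    and sum: "summable \<gamma>"
  shows "\<bar>blocks_sum (\<lambda>x. f x - U N x) (\<lambda>x. g x - V N x) l n q \<nu>\<bar> \<le> (\<Sum>k. \<gamma> (k + N))"
proof -
  let ?S = "\<lambda>w h. blocks_sum w h l n q \<nu>"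
  define D where "D k = ?S (\<lambda>x. f x - U k x) (\<lambda>x. g x - V k x)" for k
  have step: "\<bar>D k\<bar> \<le> \<gamma> k + \<bar>D (Suc k)\<bar>" and \<gamma>0: "0 \<le> \<gamma> k" if k: "N \<le> k" for k
  proof -
    let ?A = "?S (\<lambda>x. U (Suc k) x - U k x) (\<lambda>x. g x - V k x)"
    let ?B = "?S (\<lambda>x. f x - U (Suc k) x) (\<lambda>x. V (Suc k) x - V k x)"
    have "ereal \<bar>?A\<bar> \<le> ereal (\<Theta> k) * total_variation (\<lambda>x. U (Suc k) x - U k x) a b"
      by (rule blocks_sum_left_TV[OF ab B \<Theta>(1)]) (rule gV[OF k])
    moreover have "ereal \<bar>?B\<bar> \<le> ereal (\<eta> k) * total_variation (\<lambda>x. V (Suc k) x - V k x) a b"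
      by (rule blocks_sum_right_TV[OF ab B \<eta>(1)]) (rule fU[OF k])
    ultimately have "ereal \<bar>?A\<bar> + ereal \<bar>?B\<bar> \<le> ereal (\<gamma> k)"
      using \<gamma>[OF k] by (meson add_mono order_trans)
    then have le: "\<bar>?A\<bar> + \<bar>?B\<bar> \<le> \<gamma> k" by simp
    moreover have "D k = ?A + ?B + D (Suc k)"
      unfolding D_def by (simp add: blocks_sum_diff_left blocks_sum_diff_right)
    ultimately show "\<bar>D k\<bar> \<le> \<gamma> k + \<bar>D (Suc k)\<bar>" by linarith
    show "0 \<le> \<gamma> k" using le by linarith
  qed
  have part: "\<bar>D N\<bar> \<le> (\<Sum>k<M. \<gamma> (k + N)) + \<bar>D (M + N)\<bar>" for M
  proof (induction M)
    case (Suc M)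
    then show ?case using step[of "M + N"] by simp
  qed simp
  have sN: "summable (\<lambda>k. \<gamma> (k + N))" using sum by (simp add: summable_iff_shift)
  \<comment> \<open>\<open>K\<close> depends on the blocks and on \<open>C\<close> but not on
    \<open>M\<close>, so \<open>M\<close> may tend to infinity.\<close>
  define K where "K = (\<Sum>i<l. \<Sum>j<n i. 2 * C)"
  have bound: "\<bar>D N\<bar> \<le> (\<Sum>k. \<gamma> (k + N)) + K * \<eta> (M + N)" for M
  proof -
    have "\<bar>D (Suc (M + N))\<bar> \<le> (\<Sum>i<l. \<Sum>j<n i. \<eta> (M + N) * (2 * C))"
      unfolding D_def
    proof (rule blocks_sum_crude[OF B])
      fix i x assume i: "i < l" "p i \<le> x" "x \<le> p (Suc i)"
      show "\<bar>(f x - U (Suc (M + N)) x) - (f (p i) - U (Suc (M + N)) (p i))\<bar> \<le> \<eta> (M + N)"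
        by (rule fU) (use i in auto)
      show "\<bar>(g (p (Suc i)) - V (Suc (M + N)) (p (Suc i))) - (g x - V (Suc (M + N)) x)\<bar> \<le> C"
        by (rule order_trans[OF gV \<Theta>(2)]) (use i in auto)
    qed
    also have "\<dots> = K * \<eta> (M + N)"
      unfolding K_def sum_distrib_right by (simp add: mult.commute)
    finally have "\<bar>D (Suc M + N)\<bar> \<le> K * \<eta> (M + N)" by simp
    moreover have "(\<Sum>k<Suc M. \<gamma> (k + N)) \<le> (\<Sum>k. \<gamma> (k + N))"
      by (rule sum_le_suminf[OF sN]) (auto intro: \<gamma>0)
    ultimately show ?thesis using part[of "Suc M"] by linarith
  qed
  have "(\<lambda>M. (\<Sum>k. \<gamma> (k + N)) + K * \<eta> (M + N)) \<longlonglongrightarrow> (\<Sum>k. \<gamma> (k + N)) + K * 0"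
    by (intro tendsto_intros LIMSEQ_ignore_initial_segment \<eta>(2))
  from LIMSEQ_le_const[OF this] show ?thesis using bound by (auto simp: D_def)
qed

section \<open>Vanishing blockwise sums when one function has bounded variation\<close>

text \<open>This is the Cauchy criterion in the form that \<open>RS_has_integral_exists\<close>
  consumes.\<close>

definition vanishing_blocks_sum :: "(real \<Rightarrow> real) \<Rightarrow> (real \<Rightarrow> real) \<Rightarrow> real \<Rightarrow> real \<Rightarrow> bool" where
  "vanishing_blocks_sum f g a b \<longleftrightarrow> (\<forall>\<epsilon>>0. \<exists>\<delta>>0. \<forall>l p n q \<nu>. blocks a b l p n q \<nu> \<longrightarrow>
    (\<forall>i<l. p (Suc i) - p i < \<delta>) \<longrightarrow> \<bar>blocks_sum f g l n q \<nu>\<bar> \<le> \<epsilon>)"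

lemma blocks_sum_zero_left: "blocks_sum (\<lambda>x. 0) h l n q \<nu> = 0"
  by (simp add: blocks_sum_def block_sum_def)

lemma blocks_sum_zero_right: "blocks_sum w (\<lambda>x. 0) l n q \<nu> = 0"
  by (simp add: blocks_sum_def block_sum_def)

lemma exists_mult_le:
  fixes A \<epsilon> :: real
  assumes "0 \<le> A" "0 < \<epsilon>"
  obtains \<theta> where "0 < \<theta>" "\<theta> * A \<le> \<epsilon>"
  by (rule that[of "\<epsilon> / (A + 1)"]) (use assms in \<open>auto simp: field_simps\<close>)

text \<open>With \<open>u = f\<close> the remainder vanishes and \<open>\<eta>\<close> may be 0. The
  variation of \<open>f\<close> is fixed first, and then \<open>v\<close> is taken close enough to
  \<open>g\<close> to offset it.\<close>

lemma vanishing_blocks_sum_var_dom_left: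
  assumes ab: "a \<le> b"
    and cont: "\<forall>x\<in>{a..b}. continuous (at x within {a..b}) f \<or> continuous (at x within {a..b}) g"
    and f: "var_dom a b f U" and g: "regulated_on a b g"
  shows "vanishing_blocks_sum f g a b"
  unfolding vanishing_blocks_sum_def
proof (intro allI impI)
  fix \<epsilon> :: real assume \<epsilon>: "0 < \<epsilon>"
  obtain \<theta> where \<theta>: "0 < \<theta>" "\<theta> * (U b - U a) \<le> \<epsilon> / 4"
    using exists_mult_le[of "U b - U a" "\<epsilon> / 4"] var_dom_mono[OF f, of a b] ab \<epsilon> by auto
  obtain v V where v: "var_dom a b v V" and gv: "\<forall>t\<in>{a..b}. \<bar>g t - v t\<bar> \<le> \<theta> / 2"
    using regulated_approx[OF g ab half_gt_zero[OF \<theta>(1)]] by blast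
  have "\<exists>\<delta>>0. \<forall>l p n q \<nu>. blocks a b l p n q \<nu> \<longrightarrow> (\<forall>i<l. p (Suc i) - p i < \<delta>) \<longrightarrow>
    \<bar>blocks_sum f g l n q \<nu>\<bar> \<le> 4 * (\<epsilon> / 4)"
  proof (rule blocks_sum_small[OF ab cont _ f v _ _ _ \<theta>(2)])
    fix x y assume "x \<in> {a..b}" "y \<in> {a..b}"
    then have "\<bar>g x - v x\<bar> \<le> \<theta> / 2" "\<bar>g y - v y\<bar> \<le> \<theta> / 2" using gv by blast+
    then show "\<bar>(g x - v x) - (g y - v y)\<bar> \<le> \<theta>" by linarith
    show "\<bar>(f x - f x) - (f y - f y)\<bar> \<le> 0" by simp
  qed (use \<epsilon> in \<open>auto simp: blocks_sum_zero_left\<close>)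
  then show "\<exists>\<delta>>0. \<forall>l p n q \<nu>. blocks a b l p n q \<nu> \<longrightarrow> (\<forall>i<l. p (Suc i) - p i < \<delta>) \<longrightarrow>
    \<bar>blocks_sum f g l n q \<nu>\<bar> \<le> \<epsilon>" by simp
qed

text \<open>The same with \<open>v = g\<close>, \<open>\<theta>\<close> equal to 0, and
  \<open>u\<close> close to \<open>f\<close>.\<close>

lemma vanishing_blocks_sum_var_dom_right:
  assumes ab: "a \<le> b"
    and cont: "\<forall>x\<in>{a..b}. continuous (at x within {a..b}) f \<or> continuous (at x within {a..b}) g"
    and f: "regulated_on a b f" and g: "var_dom a b g V"
  shows "vanishing_blocks_sum f g a b"
  unfolding vanishing_blocks_sum_def
proof (intro allI impI)
  fix \<epsilon> :: real assume \<epsilon>: "0 < \<epsilon>"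
  obtain \<eta> where \<eta>: "0 < \<eta>" "\<eta> * (V b - V a) \<le> \<epsilon> / 4"
    using exists_mult_le[of "V b - V a" "\<epsilon> / 4"] var_dom_mono[OF g, of a b] ab \<epsilon> by auto
  obtain u U where u: "var_dom a b u U" and fu: "\<forall>t\<in>{a..b}. \<bar>f t - u t\<bar> \<le> \<eta> / 2"
    using regulated_approx[OF f ab half_gt_zero[OF \<eta>(1)]] by blast
  have "\<exists>\<delta>>0. \<forall>l p n q \<nu>. blocks a b l p n q \<nu> \<longrightarrow> (\<forall>i<l. p (Suc i) - p i < \<delta>) \<longrightarrow>
    \<bar>blocks_sum f g l n q \<nu>\<bar> \<le> 4 * (\<epsilon> / 4)"
  proof (rule blocks_sum_small[OF ab cont _ u g _ _ \<eta>(2)])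
    fix x y assume "x \<in> {a..b}" "y \<in> {a..b}"
    then have "\<bar>f x - u x\<bar> \<le> \<eta> / 2" "\<bar>f y - u y\<bar> \<le> \<eta> / 2" using fu by blast+
    then show "\<bar>(f x - u x) - (f y - u y)\<bar> \<le> \<eta>" by linarith
    show "\<bar>(g x - g x) - (g y - g y)\<bar> \<le> 0" by simp
  qed (use \<epsilon> in \<open>auto simp: blocks_sum_zero_right\<close>)
  then show "\<exists>\<delta>>0. \<forall>l p n q \<nu>. blocks a b l p n q \<nu> \<longrightarrow> (\<forall>i<l. p (Suc i) - p i < \<delta>) \<longrightarrow>
    \<bar>blocks_sum f g l n q \<nu>\<bar> \<le> \<epsilon>" by simp
qed

section \<open>The two series, existence and the final estimate\<close>

lemma ereal_suminf_finite_real: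
  fixes x :: "nat \<Rightarrow> ereal"
  assumes "\<And>k. 0 \<le> x k" "(\<Sum>k. x k) < \<infinity>"
  obtains \<alpha> where "\<And>k. x k = ereal (\<alpha> k)" "\<And>k. 0 \<le> \<alpha> k" "summable \<alpha>" "(\<Sum>k. x k) = ereal (\<Sum>k. \<alpha> k)"
proof -
  define \<alpha> where "\<alpha> k = real_of_ereal (x k)" for k
  have s: "summable \<alpha>" unfolding \<alpha>_def by (rule summable_real_of_ereal) (use assms in auto)
  have "x k \<noteq> \<infinity>" for k using assms suminf_PInfty by force
  then have x: "x k = ereal (\<alpha> k)" for k
    unfolding \<alpha>_def using assms(1)[of k] by (metis abs_ereal_ge0 ereal_real)
  have "0 \<le> \<alpha> k" for k using assms(1)[of k] x[of k] by simp
  moreover have "(\<Sum>k. x k) = ereal (\<Sum>k. \<alpha> k)" unfolding x by (rule suminf_ereal'[OF s])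
  ultimately show ?thesis using that x s by blast
qed

theorem theorem2:
  fixes f g :: "real \<Rightarrow> real" and a b :: real and \<eta> \<theta> :: "nat \<Rightarrow> real"
  assumes "a < b"
    and "regulated_on a b f" and "regulated_on a b g"
    and "\<forall>x\<in>{a..b}. continuous (at x within {a..b}) f \<or> continuous (at x within {a..b}) g"
    and "\<forall>k. 0 \<le> \<eta> k" and "decseq \<eta>" and "\<eta> \<longlonglongrightarrow> 0"
    and "\<forall>k. 0 \<le> \<theta> k" and "decseq \<theta>" and "\<theta> \<longlonglongrightarrow> 0"
    and "\<theta>m1 = (SUP t\<in>{a..b}. \<bar>g b - g t\<bar>)"
    and "S = (\<Sum>k. ereal (2 ^ k * (if k = 0 then \<theta>m1 else \<theta> (k - 1)))
                     * truncated_variation f a b (\<eta> k))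
           + (\<Sum>k. ereal (2 ^ k * \<eta> k) * truncated_variation g a b (\<theta> k))"
    and "S < \<infinity>"
  shows "\<exists>I. RS_has_integral f g a b I \<and> ereal \<bar>I - f a * (g b - g a)\<bar> \<le> S"
proof -
  have ab: "a \<le> b" using assms(1) by simp
  have \<eta>0: "0 \<le> \<eta> k" and \<theta>0: "0 \<le> \<theta> k" for k using assms(5,8) by auto
  let ?Tf = "\<lambda>k. truncated_variation f a b (\<eta> k)" and ?Tg = "\<lambda>k. truncated_variation g a b (\<theta> k)"
  \<comment> \<open>The sequence \<open>\<theta>\<close> delayed by one index, starting with its
    value at index -1.\<close>
  define \<Theta> where "\<Theta> k = (if k = 0 then \<theta>m1 else \<theta> (k - 1))" for k
  have T0: "0 \<le> ?Tf k" "0 \<le> ?Tg k" for k by (rule truncated_variation_nonneg)+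
  have \<theta>m1: "\<bar>g b - g t\<bar> \<le> \<theta>m1" if "t \<in> {a..b}" for t
  proof -
    \<comment> \<open>A real supremum is an upper bound only for a bounded set; a regulated
      \<open>g\<close> is bounded, being within 1 of a function of bounded variation.\<close>
    obtain v V where v: "var_dom a b v V" "\<forall>t\<in>{a..b}. \<bar>g t - v t\<bar> \<le> 1"
      using regulated_approx[OF assms(3) ab zero_less_one] by blast
    have "\<bar>g b - g s\<bar> \<le> V b - V a + 2" if "s \<in> {a..b}" for s
    proof -
      have "\<bar>v b - v s\<bar> \<le> V b - V s" "V a \<le> V s"
        using that by (auto intro: var_domD[OF v(1)] var_dom_mono[OF v(1)])
      moreover have "\<bar>g s - v s\<bar> \<le> 1" "\<bar>g b - v b\<bar> \<le> 1" using v(2) that ab by auto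
      ultimately show ?thesis by linarith
    qed
    then have "bdd_above ((\<lambda>t. \<bar>g b - g t\<bar>) ` {a..b})" by (rule bdd_aboveI2)
    then show ?thesis unfolding assms(11) using that by (rule cSUP_upper[rotated])
  qed
  have \<Theta>0: "0 \<le> \<Theta> k" for k using \<theta>m1[of b] ab \<theta>0 by (auto simp: \<Theta>_def)
  \<comment> \<open>One bound for all weights \<open>\<Theta> k\<close> and \<open>\<eta> k\<close>,
    used to control the error terms.\<close>
  define C where "C = max \<theta>m1 (\<theta> 0) + \<eta> 0"
  have \<eta>C: "\<eta> k \<le> C" and \<Theta>C: "\<Theta> k \<le> C" for k
    using decseqD[OF assms(6), of 0 k] decseqD[OF assms(9), of 0 "k - 1"] \<eta>0[of 0] \<theta>0[of 0] \<Theta>0[of 0]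
    by (auto simp: C_def \<Theta>_def max_def split: if_splits)
  have S: "S = (\<Sum>k. ereal (2 ^ k * \<Theta> k) * ?Tf k) + (\<Sum>k. ereal (2 ^ k * \<eta> k) * ?Tg k)"
    using assms(12) by (simp add: \<Theta>_def)
  have n1: "0 \<le> ereal (2 ^ k * \<Theta> k) * ?Tf k" and n2: "0 \<le> ereal (2 ^ k * \<eta> k) * ?Tg k" for k
    using T0 \<Theta>0 \<eta>0 by auto
  have fin: "(\<Sum>k. ereal (2 ^ k * \<Theta> k) * ?Tf k) < \<infinity>" "(\<Sum>k. ereal (2 ^ k * \<eta> k) * ?Tg k) < \<infinity>"
    using assms(13) suminf_0_le[OF n1] suminf_0_le[OF n2] unfolding S by auto
  obtain \<alpha> where \<alpha>: "\<And>k. ereal (2 ^ k * \<Theta> k) * ?Tf k = ereal (\<alpha> k)" "\<And>k. 0 \<le> \<alpha> k" "summable \<alpha>"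
    "(\<Sum>k. ereal (2 ^ k * \<Theta> k) * ?Tf k) = ereal (\<Sum>k. \<alpha> k)"
    using ereal_suminf_finite_real[OF n1 fin(1)] by blast
  obtain \<beta> where \<beta>: "\<And>k. ereal (2 ^ k * \<eta> k) * ?Tg k = ereal (\<beta> k)" "\<And>k. 0 \<le> \<beta> k" "summable \<beta>"
    "(\<Sum>k. ereal (2 ^ k * \<eta> k) * ?Tg k) = ereal (\<Sum>k. \<beta> k)"
    using ereal_suminf_finite_real[OF n2 fin(2)] by blast
  \<comment> \<open>Common estimate for both series, with \<open>s\<close> either
    \<open>\<Theta> k\<close> or \<open>\<eta> k\<close>: the weight \<open>2 ^ k\<close> reduces
    the error \<open>4 * c / 4 ^ k\<close> to order \<open>1 / 2 ^ k\<close>.\<close>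
  have weight: "ereal s * x \<le> ereal (\<rho> + 4 * c * C / 2 ^ k)"
    if "ereal (2 ^ k * s) * y = ereal \<rho>" "x \<le> ereal (2 ^ k) * (y + ereal (4 * c / 4 ^ k))"
      "0 \<le> s" "s \<le> C" "0 \<le> y" "0 < c" for s x \<rho> c k y
  proof -
    have "ereal s * x \<le> ereal s * (ereal (2 ^ k) * (y + ereal (4 * c / 4 ^ k)))"
      using that by (intro ereal_mult_left_mono) auto
    also have "\<dots> = ereal (2 ^ k * s) * (y + ereal (4 * c / 4 ^ k))"
      by (simp add: mult.assoc[symmetric] mult.commute)
    also have "\<dots> = ereal (2 ^ k * s) * y + ereal (2 ^ k * s) * ereal (4 * c / 4 ^ k)"
      using that by (intro ereal_right_distrib) auto
    also have "ereal (2 ^ k * s) * ereal (4 * c / 4 ^ k) = ereal (4 * c * s / 2 ^ k)"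
      by (simp add: field_simps flip: power_mult_distrib)
    also have "\<dots> \<le> ereal (4 * c * C / 2 ^ k)" using that by (simp add: divide_right_mono)
    finally show ?thesis using that(1) by (simp add: add_left_mono)
  qed
  \<comment> \<open>For \<open>N = 0\<close> nothing has been subtracted from \<open>g\<close>, and
    \<open>\<theta>m1\<close> only measures differences from \<open>g b\<close>; hence all blocks
    must then end at \<open>b\<close>.\<close>
  have tail: "\<bar>blocks_sum (\<lambda>x. f x - U N x) (\<lambda>x. g x - V N x) l n q \<nu>\<bar>
      \<le> (\<Sum>k. \<alpha> (k + N) + \<beta> (k + N) + 8 * c * C * (1 / 2) ^ (k + N))"
    if c: "0 < c" and U': "approximants a b f \<eta> c U" and V': "approximants a b g \<theta> c V"
      and B: "blocks a b l p n q \<nu>" and N: "N \<noteq> 0 \<or> (\<forall>i<l. p (Suc i) = b)" for c U V N l p n q \<nu>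
  proof -
    note U = approximantsD[OF U'] and V = approximantsD[OF V']
    define \<gamma> where "\<gamma> k = \<alpha> k + \<beta> k + 8 * c * C * (1 / 2) ^ k" for k
    have \<gamma>: "ereal (\<Theta> k) * total_variation (\<lambda>x. U (Suc k) x - U k x) a b
      + ereal (\<eta> k) * total_variation (\<lambda>x. V (Suc k) x - V k x) a b \<le> ereal (\<gamma> k)" for k
    proof -
      have "ereal (\<Theta> k) * total_variation (\<lambda>x. U (Suc k) x - U k x) a b \<le> ereal (\<alpha> k + 4 * c * C / 2 ^ k)"
        by (rule weight[OF \<alpha>(1) U(4) \<Theta>0 \<Theta>C T0(1) c])
      moreover have "ereal (\<eta> k) * total_variation (\<lambda>x. V (Suc k) x - V k x) a b \<le> ereal (\<beta> k + 4 * c * C / 2 ^ k)"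
        by (rule weight[OF \<beta>(1) V(4) \<eta>0 \<eta>C T0(2) c])
      ultimately have "ereal (\<Theta> k) * total_variation (\<lambda>x. U (Suc k) x - U k x) a b
        + ereal (\<eta> k) * total_variation (\<lambda>x. V (Suc k) x - V k x) a b
        \<le> ereal (\<alpha> k + 4 * c * C / 2 ^ k) + ereal (\<beta> k + 4 * c * C / 2 ^ k)" by (rule add_mono)
      also have "\<dots> = ereal (\<gamma> k)" by (simp add: \<gamma>_def power_divide)
      finally show ?thesis .
    qed
    have sum: "summable \<gamma>" unfolding \<gamma>_def
      by (intro summable_add \<alpha>(3) \<beta>(3) summable_mult summable_geometric) simp
    have "\<bar>blocks_sum (\<lambda>x. f x - U N x) (\<lambda>x. g x - V N x) l n q \<nu>\<bar> \<le> (\<Sum>k. \<gamma> (k + N))"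
    proof (rule blocks_sum_tail[OF ab B _ _ \<eta>0 assms(7) \<Theta>0 \<Theta>C \<gamma> sum])
      fix k i x assume h: "N \<le> k" "i < l" "p i \<le> x" "x \<le> p (Suc i)"
      have x: "x \<in> {a..b}" "p i \<in> {a..b}" "p (Suc i) \<in> {a..b}" using blocks_bounds[OF B h(2)] h by auto
      show "\<bar>(f x - U (Suc k) x) - (f (p i) - U (Suc k) (p i))\<bar> \<le> \<eta> k"
        using U(2)[OF x(1), of k] U(2)[OF x(2), of k] by linarith
      show "\<bar>(g (p (Suc i)) - V k (p (Suc i))) - (g x - V k x)\<bar> \<le> \<Theta> k"
      proof (cases k)
        case 0
        then show ?thesis using N h \<theta>m1[OF x(1)] by (auto simp: V(1) \<Theta>_def)
      next
        case (Suc j)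
        have "\<bar>(g (p (Suc i)) - V (Suc j) (p (Suc i))) - (g x - V (Suc j) x)\<bar> \<le> \<theta> j"
          using V(2)[OF x(1), of j] V(2)[OF x(3), of j] by linarith
        then show ?thesis using Suc by (simp add: \<Theta>_def)
      qed
    qed
    then show ?thesis unfolding \<gamma>_def .
  qed
  have "vanishing_blocks_sum f g a b"
  proof (cases "(\<exists>U. var_dom a b f U) \<or> (\<exists>V. var_dom a b g V)")
    case True
    then show ?thesis
      using vanishing_blocks_sum_var_dom_left[OF ab assms(4) _ assms(3)]
        vanishing_blocks_sum_var_dom_right[OF ab assms(4,2)] by blast
  next
    case False
    have inf: "?Tf k = \<infinity>" if "\<eta> k = 0" for k
      using var_dom_truncated_variation_zero[OF ab, of f] False that by auto
    have inf': "?Tg k = \<infinity>" if "\<theta> k = 0" for k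
      using var_dom_truncated_variation_zero[OF ab, of g] False that by auto
    \<comment> \<open>A positive weight times an infinite truncated variation would make a term
      infinite. So positivity passes from \<open>\<Theta> k\<close> to \<open>\<eta> k\<close>, then
      to \<open>\<theta> k\<close>, which is \<open>\<Theta> (Suc k)\<close>.\<close>
    have \<eta>pos: "\<eta> k > 0" if "\<Theta> k > 0" for k
      using \<alpha>(1)[of k] inf[of k] that \<eta>0[of k] by (cases "\<eta> k = 0") auto
    have \<theta>pos: "\<theta> k > 0" if "\<eta> k > 0" for k
      using \<beta>(1)[of k] inf'[of k] that \<theta>0[of k] by (cases "\<theta> k = 0") auto
    \<comment> \<open>Otherwise \<open>g\<close> would be constant on \<open>[a;b]\<close>, hence of
      bounded variation.\<close>
    have "\<theta>m1 \<noteq> 0"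
    proof
      assume "\<theta>m1 = 0"
      then have "\<bar>g y - g x\<bar> \<le> 0 - (0::real)" if "a \<le> x" "x \<le> y" "y \<le> b" for x y
        using \<theta>m1[of x] \<theta>m1[of y] that by simp
      then have "var_dom a b g (\<lambda>_. 0)" unfolding var_dom_def by blast
      then show False using False by blast
    qed
    then have \<Theta>pos: "\<Theta> k > 0" for k
    proof (induction k)
      case 0
      then show ?case using \<Theta>0[of 0] by (simp add: \<Theta>_def)
    next
      case (Suc k)
      then show ?case using \<theta>pos[OF \<eta>pos[of k]] by (simp add: \<Theta>_def)
    qed
    obtain U where U': "approximants a b f \<eta> 1 U"
      using approximants_exist[OF assms(6,5) zero_less_one] ..
    obtain V where V': "approximants a b g \<theta> 1 V"
      using approximants_exist[OF assms(9,8) zero_less_one] ..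
    note U = approximantsD[OF U'] and V = approximantsD[OF V']
    show ?thesis
      unfolding vanishing_blocks_sum_def
    proof (intro allI impI)
      fix \<epsilon> :: real assume \<epsilon>: "0 < \<epsilon>"
      define \<gamma> where "\<gamma> k = \<alpha> k + \<beta> k + 8 * 1 * C * (1 / 2) ^ k" for k
      have "summable \<gamma>" unfolding \<gamma>_def
        by (intro summable_add \<alpha>(3) \<beta>(3) summable_mult summable_geometric) simp
      then obtain N1 where N1: "\<And>N. N \<ge> N1 \<Longrightarrow> \<bar>\<Sum>k. \<gamma> (k + N)\<bar> < \<epsilon> / 4"
        using suminf_exist_split[of "\<epsilon> / 4" \<gamma>] \<epsilon> by auto
      have "(\<lambda>k. \<beta> k + \<eta> k) \<longlonglongrightarrow> 0 + 0"
        by (intro tendsto_intros summable_LIMSEQ_zero \<beta>(3) assms(7))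
      then have ev1: "eventually (\<lambda>k. \<beta> k + \<eta> k < \<epsilon> / 4) sequentially"
        using \<epsilon> by (intro order_tendstoD) auto
      have "\<Theta> \<longlonglongrightarrow> 0" by (rule LIMSEQ_imp_Suc) (simp add: \<Theta>_def assms(10))
      then have "(\<lambda>k. \<alpha> k + \<Theta> k) \<longlonglongrightarrow> 0 + 0"
        by (rule tendsto_add[OF summable_LIMSEQ_zero[OF \<alpha>(3)]])
      then have ev2: "eventually (\<lambda>k. \<alpha> k + \<Theta> k < \<epsilon> / 4) sequentially"
        using \<epsilon> by (intro order_tendstoD) auto
      \<comment> \<open>\<open>Suc N1 \<le> M\<close> makes the tail small and also gives
        \<open>M \<ge> 1\<close>, so that \<open>\<Theta> M\<close> is
        \<open>\<theta> (M - 1)\<close> and dominates \<open>\<theta> M\<close>.\<close>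
      from eventually_conj[OF eventually_conj[OF ev1 ev2] eventually_ge_at_top[of "Suc N1"]]
      obtain M where M: "\<beta> M + \<eta> M < \<epsilon> / 4" "\<alpha> M + \<Theta> M < \<epsilon> / 4" "Suc N1 \<le> M"
        using eventually_happens'[OF sequentially_bot] by force
      \<comment> \<open>A positive weight and a finite series term force the truncated variation
        \<open>y\<close> to be finite. The factor \<open>2 ^ M \<ge> 1\<close> is dropped, and the
        extra \<open>s\<close> pays for the approximation error 1.\<close>
      have var: "\<exists>W. var_dom a b w W \<and> s * (W b - W a) \<le> \<rho> + s"
        if "total_variation w a b \<le> y + ereal 1" "ereal (2 ^ M * s) * y = ereal \<rho>" "0 < s" "0 \<le> y" for w y s \<rho>
      proof -
        have "ereal (2 ^ M * s) * \<infinity> = \<infinity>" using that(3) by simp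
        then have "y \<noteq> \<infinity>" using that(2) by (metis PInfty_neq_ereal(1))
        then obtain r where r: "y = ereal r" using \<open>0 \<le> y\<close> by (cases y) auto
        then have "total_variation w a b < \<infinity>" using that(1) by auto
        then obtain W where W: "var_dom a b w W" "ereal (W b - W a) \<le> total_variation w a b"
          using var_dom_total_variation ab by blast
        have "ereal (W b - W a) \<le> ereal (r + 1)" using order_trans[OF W(2) that(1)] r by simp
        then have "s * (W b - W a) \<le> s * (r + 1)" using that(3) by simp
        also have "1 * (s * r) \<le> 2 ^ M * (s * r)" using that(3,4) r by (intro mult_right_mono) auto
        then have "s * (r + 1) \<le> \<rho> + s" using that(2) r by (simp add: algebra_simps)
        finally show ?thesis using W(1) by blast
      qed
      obtain X where X: "var_dom a b (U (Suc M)) X" "\<Theta> M * (X b - X a) \<le> \<alpha> M + \<Theta> M"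
        using var[OF U(3) \<alpha>(1) \<Theta>pos T0(1)] by blast
      obtain Y where Y: "var_dom a b (V (Suc M)) Y" "\<eta> M * (Y b - Y a) \<le> \<beta> M + \<eta> M"
        using var[OF V(3) \<beta>(1) \<eta>pos[OF \<Theta>pos] T0(2)] by blast
      have "\<theta> M \<le> \<Theta> M" using M(3) decseqD[OF assms(9), of "M - 1" M] by (simp add: \<Theta>_def)
      then have X': "\<theta> M * (X b - X a) \<le> \<Theta> M * (X b - X a)"
        using var_dom_mono[OF X(1), of a b] ab by (intro mult_right_mono) auto
      have "\<exists>\<delta>>0. \<forall>l p n q \<nu>. blocks a b l p n q \<nu> \<longrightarrow> (\<forall>i<l. p (Suc i) - p i < \<delta>) \<longrightarrow>
        \<bar>blocks_sum f g l n q \<nu>\<bar> \<le> 4 * (\<epsilon> / 4)"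
      proof (rule blocks_sum_small[OF ab assms(4) _ X(1) Y(1)])
        fix x y assume h: "x \<in> {a..b}" "y \<in> {a..b}"
        show "\<bar>(f x - U (Suc M) x) - (f y - U (Suc M) y)\<bar> \<le> \<eta> M"
          using U(2)[OF h(1), of M] U(2)[OF h(2), of M] by linarith
        show "\<bar>(g x - V (Suc M) x) - (g y - V (Suc M) y)\<bar> \<le> \<theta> M"
          using V(2)[OF h(1), of M] V(2)[OF h(2), of M] by linarith
      next
        fix l p n q \<nu> assume "blocks a b l p n q \<nu>"
        from tail[OF zero_less_one U' V' this, of "Suc M"] N1[of "Suc M"] M(3)
        show "\<bar>blocks_sum (\<lambda>x. f x - U (Suc M) x) (\<lambda>x. g x - V (Suc M) x) l n q \<nu>\<bar> \<le> \<epsilon> / 4"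
          unfolding \<gamma>_def by linarith
      qed (use \<epsilon> M X(2) X' Y(2) in auto)
      then show "\<exists>\<delta>>0. \<forall>l p n q \<nu>. blocks a b l p n q \<nu> \<longrightarrow> (\<forall>i<l. p (Suc i) - p i < \<delta>) \<longrightarrow>
        \<bar>blocks_sum f g l n q \<nu>\<bar> \<le> \<epsilon>" by simp
    qed
  qed
  then obtain I where I: "RS_has_integral f g a b I"
    using RS_has_integral_exists[OF assms(1), of f g] unfolding vanishing_blocks_sum_def by blast
  have bound: "\<bar>RS_sum f g l p \<nu> - f a * (g b - g a)\<bar> \<le> (\<Sum>k. \<alpha> k) + (\<Sum>k. \<beta> k)"
    if t: "tagged a b l p \<nu>" for l p \<nu>
  proof (rule field_le_epsilon)
    fix e :: real assume e: "0 < e"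
    \<comment> \<open>The errors sum to \<open>8 * c * C\<close> times the geometric sum 2.\<close>
    obtain c where c: "0 < c" "c * (16 * C) \<le> e"
      using exists_mult_le[of "16 * C" e] e \<eta>0[of 0] \<eta>C[of 0] by auto
    \<comment> \<open>The whole interval is one block ending at \<open>b\<close>, so the tail
      estimate applies from \<open>N = 0\<close>, where both approximants are 0.\<close>
    let ?P = "\<lambda>i. if i = 0 then a else b"
    have B: "blocks a b (Suc 0) ?P (\<lambda>_. l) (\<lambda>_. p) (\<lambda>_. \<nu>)" using t by (simp add: blocks_def)
    obtain U where U: "approximants a b f \<eta> c U"
      using approximants_exist[OF assms(6,5) c(1)] ..
    obtain V where V: "approximants a b g \<theta> c V"
      using approximants_exist[OF assms(9,8) c(1)] ..
    have geo: "summable (\<lambda>k. (1 / 2 :: real) ^ k)" by (rule summable_geometric) simp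
    from tail[OF c(1) U V B, of 0]
    have "\<bar>blocks_sum f g (Suc 0) (\<lambda>_. l) (\<lambda>_. p) (\<lambda>_. \<nu>)\<bar> \<le> (\<Sum>k. \<alpha> k + \<beta> k + 8 * c * C * (1 / 2) ^ k)"
      by (simp add: approximantsD(1)[OF U] approximantsD(1)[OF V])
    also have "\<dots> = (\<Sum>k. \<alpha> k) + (\<Sum>k. \<beta> k) + 8 * c * C * (\<Sum>k. (1 / 2) ^ k)"
      using \<alpha>(3) \<beta>(3) geo by (simp add: suminf_add[symmetric] summable_add summable_mult suminf_mult)
    also have "(\<Sum>k. (1 / 2) ^ k) = (2::real)" by (subst suminf_geometric) auto
    also have "blocks_sum f g (Suc 0) (\<lambda>_. l) (\<lambda>_. p) (\<lambda>_. \<nu>) = RS_sum f g l p \<nu> - f a * (g b - g a)"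
      using sum_lessThan_telescope[of "\<lambda>j. g (p j)" l] t
      by (simp add: blocks_sum_def block_sum_def RS_sum_def tagged_def left_diff_distrib sum_subtractf
          flip: sum_distrib_left)
    finally show "\<bar>RS_sum f g l p \<nu> - f a * (g b - g a)\<bar> \<le> (\<Sum>k. \<alpha> k) + (\<Sum>k. \<beta> k) + e"
      using c(2) by (simp add: algebra_simps)
  qed
  have "\<bar>I - f a * (g b - g a)\<bar> \<le> (\<Sum>k. \<alpha> k) + (\<Sum>k. \<beta> k)"
    by (rule RS_has_integral_bound[OF I assms(1) bound])
  then show ?thesis using I unfolding S \<alpha>(4) \<beta>(4) by auto
qed

end
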